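(* For every integer $m\ge 8$ with $m\equiv 0$ or $1\pmod 4$, the number of distinct Skolem circles of order $m$ is at least \[\frac{2^{\lfloor m/3\rfloor-1}}{2+\log_2(m)}+1.\]
   Context: Let $C_{2m}$ be the cycle graph with vertices $v_1,\dots,v_{2m}$ in cyclic order. A Skolem circle of order $m$ is a labelling of the vertices of $C_{2m}$ by labels from $\{1,\dots,m\}$ such that each label is used exactly twice and any two vertices with the same label $s$ are at distance exactly $s$ in $C_{2m}$. Two Skolem circles are regarded as the same (circle equivalent) if one is obtained from the other by a rotation or a reflection of the cycle; "distinct Skolem circles" means distinct equivalence classes. *)

theory Defs
  imports "HOL-Analysis.Analysis" "HOL-Number_Theory.Cong" "Graph_Theory.Pair_Digraph" "Graph_Theory.Shortest_Path"
begin

text \<open>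
  The cycle on \<open>n\<close> vertices, as a symmetric digraph; the vertices \<open>v\<^sub>1, \<dots>, v\<^sub>n\<close>
  are \<open>0, \<dots>, n - 1\<close>.
\<close>

definition cycle_graph :: "nat \<Rightarrow> nat pair_pre_digraph" where
  "cycle_graph n = \<lparr> pverts = {0..<n},
     parcs = {(u, v). u < n \<and> v < n \<and> (v = (u + 1) mod n \<or> u = (v + 1) mod n)} \<rparr>"

text \<open>The constant \<open>wf_digraph.\<mu>\<close> is specified only for well-formed digraphs.\<close>

lemma wf_cycle_graph: "wf_digraph (with_proj (cycle_graph n))"
  by unfold_locales (auto simp: cycle_graph_def)

text \<open>With unit arc weights, the cost of a shortest path is the graph distance.\<close>

definition cycle_dist :: "nat \<Rightarrow> nat \<Rightarrow> nat \<Rightarrow> ereal" where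
  "cycle_dist n u v = wf_digraph.\<mu> (with_proj (cycle_graph n)) (\<lambda>_. 1) u v"

definition skolem_circles :: "nat \<Rightarrow> (nat \<Rightarrow> nat) set" where
  "skolem_circles m = {f \<in> pverts (cycle_graph (2 * m)) \<rightarrow>\<^sub>E {1..m}.
     (\<forall>s \<in> {1..m}. card {v \<in> pverts (cycle_graph (2 * m)). f v = s} = 2) \<and>
     (\<forall>u \<in> pverts (cycle_graph (2 * m)). \<forall>v \<in> pverts (cycle_graph (2 * m)).
        u \<noteq> v \<longrightarrow> f u = f v \<longrightarrow> cycle_dist (2 * m) u v = ereal (real (f u)))}"

definition rotation :: "nat \<Rightarrow> nat \<Rightarrow> nat \<Rightarrow> nat" where
  "rotation n k v = (v + k) mod n"

text \<open>
  \<open>reflection n k\<close> maps \<open>v\<close> to \<open>k - v\<close> modulo \<open>n\<close>; writing \<open>n - v\<close> avoids truncation for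
  \<open>v < n\<close>. As \<open>k\<close> varies, these are all the reflections of the cycle.
\<close>

definition reflection :: "nat \<Rightarrow> nat \<Rightarrow> nat \<Rightarrow> nat" where
  "reflection n k v = (k + (n - v)) mod n"

definition circle_equiv :: "nat \<Rightarrow> ((nat \<Rightarrow> nat) \<times> (nat \<Rightarrow> nat)) set" where
  "circle_equiv m = {(f, g). f \<in> skolem_circles m \<and> g \<in> skolem_circles m \<and>
     (\<exists>k. (\<forall>v < 2 * m. g v = f (rotation (2 * m) k v)) \<or>
          (\<forall>v < 2 * m. g v = f (reflection (2 * m) k v)))}"

lemma rotation_less: "v < n \<Longrightarrow> rotation n k v < n"
  and reflection_less: "v < n \<Longrightarrow> reflection n k v < n"
  by (simp_all add: rotation_def reflection_def)

lemma int_rotation: "int (rotation n k v) = (int v + int k) mod int n"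
  by (simp add: rotation_def zmod_int)

lemma int_reflection: "v < n \<Longrightarrow> int (reflection n k v) = (int k - int v) mod int n"
  using mod_add_self2[of "int k - int v" "int n"]
  by (simp add: reflection_def zmod_int of_nat_diff algebra_simps)

lemma rotation_rotation: "v < n \<Longrightarrow> rotation n k (rotation n l v) = rotation n (k + l) v"
  unfolding rotation_def by (simp add: mod_simps ac_simps)

lemma rotation_reflection: "v < n \<Longrightarrow> rotation n k (reflection n l v) = reflection n (k + l) v"
  unfolding rotation_def reflection_def by (simp add: mod_simps ac_simps)

lemma int_minus_mod:
  assumes "0 < n"
  shows "int (n - l mod n) = int n * (1 + int l div int n) - int l"
proof -
  have "int (n - l mod n) = int n - int l mod int n"
    using assms by (simp add: of_nat_diff zmod_int less_imp_le)
  then show ?thesis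
    by (simp add: minus_div_mult_eq_mod [symmetric] algebra_simps)
qed

lemma reflection_rotation:
  assumes "v < n"
  shows "reflection n k (rotation n l v) = reflection n (k + (n - l mod n)) v"
proof -
  define q where "q = 1 + int l div int n"
  have *: "int (n - l mod n) = int n * q - int l"
    using assms int_minus_mod[of n l] by (simp add: q_def)
  have "int (reflection n (k + (n - l mod n)) v) = ((int k - int v - int l) + int n * q) mod int n"
    unfolding int_reflection[OF assms] of_nat_add * by (simp add: algebra_simps)
  also have "\<dots> = (int k - int v - int l) mod int n"
    by (rule mod_mult_self2)
  also have "\<dots> = int (reflection n k (rotation n l v))"
    unfolding int_reflection[OF rotation_less[OF assms]] int_rotation
    by (simp add: mod_simps algebra_simps)
  finally show ?thesis by linarith
qed

lemma reflection_reflection: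
  assumes "v < n"
  shows "reflection n k (reflection n l v) = rotation n (k + (n - l mod n)) v"
proof -
  define q where "q = 1 + int l div int n"
  have *: "int (n - l mod n) = int n * q - int l"
    using assms int_minus_mod[of n l] by (simp add: q_def)
  have "int (rotation n (k + (n - l mod n)) v) = ((int k + int v - int l) + int n * q) mod int n"
    unfolding int_rotation of_nat_add * by (simp add: algebra_simps)
  also have "\<dots> = (int k + int v - int l) mod int n"
    by (rule mod_mult_self2)
  also have "\<dots> = int (reflection n k (reflection n l v))"
    unfolding int_reflection[OF reflection_less[OF assms]] int_reflection[OF assms]
    by (simp add: mod_simps algebra_simps)
  finally show ?thesis by linarith
qed

lemma rotation_inverse:
  assumes "v < n"
  shows "rotation n k (rotation n (n - k mod n) v) = v"
proof -
  define q where "q = 1 + int k div int n"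
  have *: "int (n - k mod n) = int n * q - int k"
    using assms int_minus_mod[of n k] by (simp add: q_def)
  have "int (rotation n k (rotation n (n - k mod n) v)) = (int v + int n * q) mod int n"
    unfolding int_rotation * by (simp add: mod_simps algebra_simps)
  also have "\<dots> = int v mod int n"
    by (rule mod_mult_self2)
  finally show ?thesis
    using assms by simp
qed

lemma reflection_inverse:
  assumes "v < n"
  shows "reflection n k (reflection n k v) = v"
proof -
  have "int (reflection n k (reflection n k v)) = int v"
    using assms by (simp add: int_reflection reflection_less mod_simps)
  then show ?thesis by simp
qed

lemma equiv_circle_equiv: "equiv (skolem_circles m) (circle_equiv m)"
proof (rule equivI)
  show "circle_equiv m \<subseteq> skolem_circles m \<times> skolem_circles m"
    by (auto simp: circle_equiv_def)
  show "refl_on (skolem_circles m) (circle_equiv m)"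
    by (auto simp: refl_on_def circle_equiv_def rotation_def intro!: exI[of _ 0])
  show "sym (circle_equiv m)"
  proof (rule symI)
    fix f g assume "(f, g) \<in> circle_equiv m"
    then obtain k where S: "f \<in> skolem_circles m" "g \<in> skolem_circles m" and
      "(\<forall>v < 2 * m. g v = f (rotation (2 * m) k v)) \<or>
       (\<forall>v < 2 * m. g v = f (reflection (2 * m) k v))"
      by (auto simp: circle_equiv_def)
    then consider "\<forall>v < 2 * m. f v = g (rotation (2 * m) (2 * m - k mod (2 * m)) v)"
      | "\<forall>v < 2 * m. f v = g (reflection (2 * m) k v)"
      by (metis rotation_less reflection_less rotation_inverse reflection_inverse)
    then show "(g, f) \<in> circle_equiv m"
      using S by cases (auto simp: circle_equiv_def)
  qed
  show "trans (circle_equiv m)"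
  proof (rule transI)
    fix f g h assume fg: "(f, g) \<in> circle_equiv m" and gh: "(g, h) \<in> circle_equiv m"
    from fg obtain k where k: "(\<forall>v < 2 * m. g v = f (rotation (2 * m) k v)) \<or>
       (\<forall>v < 2 * m. g v = f (reflection (2 * m) k v))"
      by (auto simp: circle_equiv_def)
    from gh obtain l where l: "(\<forall>v < 2 * m. h v = g (rotation (2 * m) l v)) \<or>
       (\<forall>v < 2 * m. h v = g (reflection (2 * m) l v))"
      by (auto simp: circle_equiv_def)
    have "\<exists>j. (\<forall>v < 2 * m. h v = f (rotation (2 * m) j v)) \<or>
       (\<forall>v < 2 * m. h v = f (reflection (2 * m) j v))"
      using k l rotation_rotation[of _ "2 * m" k l] rotation_reflection[of _ "2 * m" k l]
        reflection_rotation[of _ "2 * m" k l] reflection_reflection[of _ "2 * m" k l]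
        rotation_less[of _ "2 * m" l] reflection_less[of _ "2 * m" l]
      by (elim disjE) metis+
    then show "(f, h) \<in> circle_equiv m"
      using fg gh by (auto simp: circle_equiv_def)
  qed
qed

definition num_skolem_circles :: "nat \<Rightarrow> nat" where
  "num_skolem_circles m = card (skolem_circles m // circle_equiv m)"

end

(*
  Positions are taken modulo 2m. If a + b = c, the labels a, b, c can be put on the positions
  a, -a, b, -b, c, -c in two ways, which are mirror images under v -> -v. So each partition of
  {1..m-1} into triples a + b = c, up to boundedly many elements that are matched by a fixed
  "core", gives exponentially many Skolem circles, one for each choice of the triples to be
  mirrored. Two labels that are never mirrored, one of them m, leave no symmetry of the cycle
  except the identity, so these circles are pairwise inequivalent.

  The partitions come from Skolem sequences for m = 1 (mod 3) and otherwise from Langford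
  sequences of defect 3; for m = 0 (mod 3) the latter skip the element 2m/3, because the label
  2m/3 fits on the positions 2m/3 and -2m/3.
*)
theory Submission
  imports Defs
begin

section \<open>Distances in the cycle\<close>

text \<open>The label \<open>m\<close> alone does not pin down the cycle: its two positions are
  antipodal, so the half turn and two reflections preserve them. A second fixed label below
  \<open>m\<close> excludes the half turn, and it excludes the reflections unless its pair is
  symmetric about one of their axes. Hence every construction below exhibits two fixed pairs. The
  shape of the core comes from counting modulo 3. Besides \<open>m\<close> there are m - 1 labels,
  so triples can use all of them only for m = 1 (mod 3). Taking out 1, 2, m - 2, m - 1 as well
  leaves m - 5 labels, which settles m = 2 (mod 3). For m = 0 (mod 3) one more label w < m must go,
  together with the positions w and -w; it fits on these two only if 3w = 2m. The logarithm in the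
  bound is used only through log 2 m \<ge> 3: a divisor of at least 5 leaves room for the summand 1
  and, when m = 0 (mod 3), for one lost factor 2.\<close>

lemma cycle_arc_iff:
  assumes "u < n" "v < n"
  shows "(u, v) \<in> parcs (cycle_graph n) \<longleftrightarrow>
    [int v = int u + 1] (mod int n) \<or> [int v = int u - 1] (mod int n)"
proof -
  have succ: "w = (t + 1) mod n \<longleftrightarrow> [int w = int t + 1] (mod int n)" if "w < n" for w t
    using that by (metis cong_int_iff cong_def mod_less of_nat_1 of_nat_add)
  have "[int u = int v + 1] (mod int n) \<longleftrightarrow> [int v = int u - 1] (mod int n)"
    unfolding cong_iff_dvd_diff by (metis add.commute diff_diff_eq2 dvd_minus_iff minus_diff_eq)
  with assms succ show ?thesis
    by (auto simp: cycle_graph_def)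
qed

lemma cycle_walk_exists:
  fixes t :: int
  assumes "0 < n" "u < n" "v < n" "\<bar>t\<bar> = 1" "[int v = int u + int d * t] (mod int n)"
  shows "\<exists>p. pre_digraph.awalk (with_proj (cycle_graph n)) u p v \<and> length p = d"
  using assms(2,5)
proof (induction d arbitrary: u)
  interpret wf_digraph "with_proj (cycle_graph n)" by (rule wf_cycle_graph)
  case 0
  then have "u = v"
    using assms(3) by (simp add: cong_int_iff cong_def)
  then show ?case
    using 0 by (intro exI[of _ "[]"]) (simp add: awalk_Nil_iff, simp add: cycle_graph_def)
next
  interpret wf_digraph "with_proj (cycle_graph n)" by (rule wf_cycle_graph)
  case (Suc d)
  define w where "w = nat ((int u + t) mod int n)"
  have w: "w < n" "[int w = int u + t] (mod int n)"
    using assms(1) by (simp_all add: w_def nat_less_iff cong_def)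
  have "[int v = int w + int d * t] (mod int n)"
    using cong_add[OF w(2) cong_refl[of "int d * t"]] Suc.prems(2)
    by (auto simp: algebra_simps intro: cong_trans cong_sym)
  then obtain p where p: "awalk w p v" "length p = d"
    using Suc.IH[OF w(1)] by blast
  have "t = 1 \<or> t = - 1"
    using assms(4) by linarith
  then have "(u, w) \<in> parcs (cycle_graph n)"
    using w(2) cycle_arc_iff[OF Suc.prems(1) w(1)] by auto
  moreover have "u \<in> pverts (cycle_graph n)"
    using Suc.prems(1) by (simp add: cycle_graph_def)
  ultimately have "awalk u ((u, w) # p) v"
    using p by (simp add: awalk_Cons_iff)
  with p(2) show ?case
    by (intro exI[of _ "(u, w) # p"]) auto
qed

lemma cycle_walk_length:
  assumes "pre_digraph.awalk (with_proj (cycle_graph n)) u p v"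
  shows "\<exists>j. \<bar>j\<bar> \<le> int (length p) \<and> [int v = int u + j] (mod int n)"
  using assms
proof (induction p arbitrary: u)
  interpret wf_digraph "with_proj (cycle_graph n)" by (rule wf_cycle_graph)
  case Nil
  then show ?case by (auto simp: awalk_Nil_iff)
next
  interpret wf_digraph "with_proj (cycle_graph n)" by (rule wf_cycle_graph)
  case (Cons e p)
  then obtain w where e: "e = (u, w)" "(u, w) \<in> parcs (cycle_graph n)" "awalk w p v"
    by (cases e) (auto simp: awalk_Cons_iff)
  then have "u < n" "w < n"
    by (auto simp: cycle_graph_def)
  with e(2) obtain t where t: "\<bar>t\<bar> = 1" "[int w = int u + t] (mod int n)"
    using cycle_arc_iff[of u n w] by (metis abs_1 abs_minus_cancel diff_conv_add_uminus)
  obtain j where j: "\<bar>j\<bar> \<le> int (length p)" "[int v = int w + j] (mod int n)"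
    using Cons.IH[OF e(3)] by blast
  have "[int v = int u + (t + j)] (mod int n)"
    using cong_trans[OF j(2) cong_add[OF t(2) cong_refl[of j]]] by (simp add: algebra_simps)
  with t(1) j(1) show ?case
    by (intro exI[of _ "t + j"]) auto
qed

text \<open>Walking \<open>d\<close> steps in direction \<open>t\<close> gives the upper bound. A
  walk with total displacement \<open>j\<close> is at least |j| long, and either \<open>j\<close> is
  \<open>d * t\<close> or the two differ by a nonzero multiple of \<open>n\<close>; then |j| \<ge> n
  - d \<ge> d.\<close>

lemma cycle_dist_eqI:
  fixes t :: int
  assumes "u < n" "v < n" "\<bar>t\<bar> = 1" "2 * d \<le> n" "[int v = int u + int d * t] (mod int n)"
  shows "cycle_dist n u v = ereal (real d)"
proof -
  interpret wf_digraph "with_proj (cycle_graph n)" by (rule wf_cycle_graph)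
  have cost: "awalk_cost (\<lambda>_. 1) p = real (length p)" for p
    by (induction p) auto
  have lower: "d \<le> length p" if p: "awalk u p v" for p
  proof -
    obtain j where j: "\<bar>j\<bar> \<le> int (length p)" "[int v = int u + j] (mod int n)"
      using cycle_walk_length[OF p] by blast
    have "[int d * t = j] (mod int n)"
      using cong_trans[OF cong_sym[OF assms(5)] j(2)] by (simp add: cong_add_lcancel)
    then obtain q where q: "int d * t - j = int n * q"
      by (auto simp: cong_iff_dvd_diff elim: dvdE)
    have "int d \<le> \<bar>j\<bar>"
    proof (cases "q = 0")
      case True
      with q have "\<bar>j\<bar> = int d * \<bar>t\<bar>" by (auto simp: abs_mult)
      with assms(3) show ?thesis by simp
    next
      case False
      then have "int n * 1 \<le> int n * \<bar>q\<bar>"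
        by (intro mult_left_mono) auto
      then have "int n \<le> \<bar>int n * q\<bar>"
        by (simp add: abs_mult)
      also have "\<dots> \<le> int d * \<bar>t\<bar> + \<bar>j\<bar>"
        using q[symmetric] abs_triangle_ineq4[of "int d * t" j] by (simp add: abs_mult)
      finally show ?thesis using assms(3,4) by simp
    qed
    with j(1) show ?thesis by linarith
  qed
  have "0 < n" using assms(1) by simp
  then obtain p where p: "awalk u p v" "length p = d"
    using cycle_walk_exists[OF _ assms(1-3,5)] by blast
  show ?thesis
    unfolding cycle_dist_def
  proof (rule antisym)
    show "\<mu> (\<lambda>_. 1) u v \<le> ereal (real d)"
      using min_cost_le_walk_cost[OF p(1), of "\<lambda>_. 1"] by (simp add: cost p(2))
    show "ereal (real d) \<le> \<mu> (\<lambda>_. 1) u v"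
      unfolding \<mu>_def by (rule INF_greatest) (auto simp: cost lower)
  qed
qed

section \<open>Labellings of the integers with period \<open>2m\<close>\<close>

lemma periodic_cong:
  fixes F :: "int \<Rightarrow> 'a"
  assumes per: "\<And>v. F (v + n) = F v" and "[u = v] (mod n)"
  shows "F u = F v"
proof -
  have step: "F (v + int k * n) = F v" for v k
  proof (induction k)
    case (Suc k)
    have "F (v + int (Suc k) * n) = F ((v + int k * n) + n)"
      by (simp add: algebra_simps)
    then show ?case using per Suc by simp
  qed simp
  obtain q where q: "u = v + q * n"
    using assms(2) by (metis add.commute cong_iff_lin cong_sym mult.commute)
  show ?thesis
  proof (cases "0 \<le> q")
    case True
    then show ?thesis using step[of v "nat q"] q by simp
  next
    case False
    then show ?thesis using step[of u "nat (- q)"] q by simp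
  qed
qed

text \<open>Only the existence of one pair per label is demanded, which is easy to check for a new
  labelling; counting over a period supplies uniqueness. On the integers the symmetries of the cycle
  become v -> k + v and v -> k - v.\<close>

definition skolem_labelling :: "nat \<Rightarrow> (int \<Rightarrow> nat) \<Rightarrow> bool" where
  "skolem_labelling m F \<longleftrightarrow> (\<forall>v. F (v + 2 * int m) = F v) \<and> (\<forall>v. F v \<in> {1..m}) \<and>
     (\<forall>s\<in>{1..m}. \<exists>x. F x = s \<and> F (x + int s) = s)"

lemma cong_self_mod: "[v mod n = v] (mod n)"
  by (simp add: cong_def)

lemma skolem_labelling_range: "skolem_labelling m F \<Longrightarrow> F v \<in> {1..m}"
  unfolding skolem_labelling_def by blast

lemma skolem_labelling_pos: "skolem_labelling m F \<Longrightarrow> 0 < m"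
  using skolem_labelling_range[of m F 0] by simp

lemma skolem_labelling_cong:
  assumes "skolem_labelling m F" "[u = v] (mod 2 * int m)"
  shows "F u = F v"
proof (rule periodic_cong[OF _ assms(2)])
  show "F (v + 2 * int m) = F v" for v
    using assms(1) unfolding skolem_labelling_def by blast
qed

text \<open>Each of the \<open>m\<close> labels occurs at least twice among \<open>2m\<close> positions, hence exactly twice.\<close>

lemma skolem_labelling_fibre:
  assumes F: "skolem_labelling m F" and s: "s \<in> {1..m}"
  shows "\<exists>x y. {v \<in> {0..<2 * int m}. F v = s} = {x, y} \<and> x \<noteq> y \<and> [y = x + int s] (mod 2 * int m)"
proof -
  define A where "A s = {v \<in> {0..<2 * int m}. F v = s}" for s
  have fin: "finite (A s)" for s
    unfolding A_def by (rule finite_subset[of _ "{0..<2 * int m}"]) auto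
  have two: "\<exists>x y. {x, y} \<subseteq> A s \<and> x \<noteq> y \<and> [y = x + int s] (mod 2 * int m)"
    if s: "s \<in> {1..m}" for s
  proof -
    obtain x where x: "F x = s" "F (x + int s) = s"
      using F s unfolding skolem_labelling_def by blast
    let ?x = "x mod (2 * int m)" and ?y = "(x + int s) mod (2 * int m)"
    have "F ?x = F x" "F ?y = F (x + int s)"
      by (intro skolem_labelling_cong[OF F cong_self_mod])+
    moreover have "?x \<noteq> ?y"
    proof
      assume "?x = ?y"
      then have "[x + 0 = x + int s] (mod 2 * int m)" by (simp add: cong_def)
      then have "[0 = int s] (mod 2 * int m)" by (simp only: cong_add_lcancel)
      then have "0 mod (2 * int m) = int s mod (2 * int m)" by (simp only: cong_def)
      then show False using s by simp
    qed
    moreover have "[?y = ?x + int s] (mod 2 * int m)"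
      by (simp add: cong_def mod_simps)
    ultimately show ?thesis using x s
      by (intro exI[of _ ?x] exI[of _ ?y]) (auto simp: A_def)
  qed
  have ge: "2 \<le> card (A s)" if "s \<in> {1..m}" for s
  proof -
    obtain x y where "{x, y} \<subseteq> A s" "x \<noteq> y" using two[OF \<open>s \<in> {1..m}\<close>] by blast
    then show ?thesis using card_mono[OF fin, of "{x, y}" s] by simp
  qed
  have "{0..<2 * int m} = (\<Union>s\<in>{1..m}. A s)"
    using skolem_labelling_range[OF F] by (auto simp: A_def)
  then have "2 * m = card (\<Union>s\<in>{1..m}. A s)"
    by (metis card_atLeastLessThan_int diff_zero nat_int of_nat_mult of_nat_numeral)
  also have "\<dots> = (\<Sum>s\<in>{1..m}. card (A s))"
    by (rule card_UN_disjoint) (auto simp: A_def fin intro: finite_subset[of _ "{0..<2 * int m}"])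
  finally have sum: "(\<Sum>s\<in>{1..m}. card (A s)) = (\<Sum>s\<in>{1..m}. 2)" by simp
  have "2 = card (A s)"
    by (rule sum_mono_inv[OF sum[symmetric] ge s]) simp_all
  obtain x y where xy: "{x, y} \<subseteq> A s" "x \<noteq> y" "[y = x + int s] (mod 2 * int m)"
    using two[OF s] by blast
  then have "A s = {x, y}"
    using \<open>2 = card (A s)\<close> fin by (intro card_subset_eq[symmetric]) auto
  with xy show ?thesis unfolding A_def by blast
qed

lemma skolem_labelling_positions:
  assumes F: "skolem_labelling m F" and s: "F x = s" "F (x + int s) = s" and u: "F u = s"
  shows "[u = x] (mod 2 * int m) \<or> [u = x + int s] (mod 2 * int m)"
proof -
  let ?r = "\<lambda>v. v mod (2 * int m)"
  have range: "s \<in> {1..m}" using skolem_labelling_range[OF F, of x] s by simp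
  obtain a b where ab: "{v \<in> {0..<2 * int m}. F v = s} = {a, b}"
    using skolem_labelling_fibre[OF F range] by blast
  have "?r v \<in> {v \<in> {0..<2 * int m}. F v = s}" if "F v = s" for v
    using skolem_labelling_pos[OF F] that skolem_labelling_cong[OF F cong_self_mod, of v] by simp
  then have mem: "?r v \<in> {a, b}" if "F v = s" for v
    unfolding ab using that by blast
  have "?r x \<noteq> ?r (x + int s)"
  proof
    assume "?r x = ?r (x + int s)"
    then have "2 * int m dvd int s"
      by (metis add_diff_cancel_left' mod_eq_dvd_iff)
    with range show False by (auto dest: zdvd_imp_le)
  qed
  with mem[OF s(1)] mem[OF s(2)] mem[OF u] have "?r u = ?r x \<or> ?r u = ?r (x + int s)"
    unfolding insert_iff empty_iff by metis
  then show ?thesis by (simp add: cong_def)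
qed

lemma skolem_labelling_same_label:
  assumes F: "skolem_labelling m F" and eq: "F u = F v"
  shows "[u = v] (mod 2 * int m) \<or> [u = v + int (F v)] (mod 2 * int m) \<or>
    [v = u + int (F v)] (mod 2 * int m)"
proof -
  obtain x where x: "F x = F v" "F (x + int (F v)) = F v"
    using F skolem_labelling_range[OF F, of v] unfolding skolem_labelling_def by blast
  have "[v = x] (mod 2 * int m) \<or> [v = x + int (F v)] (mod 2 * int m)"
    by (rule skolem_labelling_positions[OF F x refl])
  moreover have "[u = x] (mod 2 * int m) \<or> [u = x + int (F v)] (mod 2 * int m)"
    by (rule skolem_labelling_positions[OF F x eq])
  ultimately consider "[u = x] (mod 2 * int m)" "[v = x] (mod 2 * int m)"
    | "[u = x + int (F v)] (mod 2 * int m)" "[v = x + int (F v)] (mod 2 * int m)"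
    | "[u = x] (mod 2 * int m)" "[v = x + int (F v)] (mod 2 * int m)"
    | "[u = x + int (F v)] (mod 2 * int m)" "[v = x] (mod 2 * int m)"
    by blast
  then show ?thesis
  proof cases
    case 3
    then have "[v = u + int (F v)] (mod 2 * int m)"
      using cong_add[OF cong_sym[OF 3(1)] cong_refl[of "int (F v)"]] by (blast intro: cong_trans)
    then show ?thesis by blast
  next
    case 4
    then have "[u = v + int (F v)] (mod 2 * int m)"
      using cong_add[OF cong_sym[OF 4(2)] cong_refl[of "int (F v)"]] by (blast intro: cong_trans)
    then show ?thesis by blast
  qed (blast intro: cong_trans cong_sym)+
qed

section \<open>Skolem circles from periodic labellings, and their equivalence\<close>

definition circle_of :: "nat \<Rightarrow> (int \<Rightarrow> nat) \<Rightarrow> nat \<Rightarrow> nat" where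
  "circle_of m F = restrict (\<lambda>v. F (int v)) {0..<2 * m}"

lemma circle_of_skolem:
  assumes F: "skolem_labelling m F"
  shows "circle_of m F \<in> skolem_circles m"
proof -
  have card2: "card {v \<in> {0..<2 * m}. circle_of m F v = s} = 2" if s: "s \<in> {1..m}" for s
  proof -
    have "bij_betw int {v \<in> {0..<2 * m}. circle_of m F v = s} {v \<in> {0..<2 * int m}. F v = s}"
      by (rule bij_betwI[of _ _ _ nat]) (auto simp: circle_of_def nat_less_iff)
    then have "card {v \<in> {0..<2 * m}. circle_of m F v = s} = card {v \<in> {0..<2 * int m}. F v = s}"
      by (rule bij_betw_same_card)
    also obtain x y where "{v \<in> {0..<2 * int m}. F v = s} = {x, y}" "x \<noteq> y"
      using skolem_labelling_fibre[OF F s] by blast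
    then have "card {v \<in> {0..<2 * int m}. F v = s} = 2" by simp
    finally show ?thesis .
  qed
  have dist: "cycle_dist (2 * m) u v = ereal (real (circle_of m F u))"
    if uv: "u < 2 * m" "v < 2 * m" "u \<noteq> v" "circle_of m F u = circle_of m F v" for u v
  proof -
    have eq: "F (int u) = F (int v)" using uv by (simp add: circle_of_def)
    have "\<not> [int u = int v] (mod 2 * int m)"
      using uv by (metis cong_int_iff cong_less_modulus_unique_nat of_nat_mult of_nat_numeral)
    with skolem_labelling_same_label[OF F eq]
    consider "[int u = int v + int (F (int v))] (mod 2 * int m)"
      | "[int v = int u + int (F (int v))] (mod 2 * int m)"
      by blast
    then obtain t :: int where t: "\<bar>t\<bar> = 1" "[int v = int u + int (F (int v)) * t] (mod 2 * int m)"
    proof cases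
      case 1
      then have "[int v = int u + int (F (int v)) * (- 1)] (mod 2 * int m)"
        unfolding cong_iff_dvd_diff by (simp add: dvd_diff_commute algebra_simps)
      then show ?thesis using that[of "- 1"] by simp
    next
      case 2
      then show ?thesis using that[of 1] by simp
    qed
    \<comment> \<open>A label is at most half the length 2m of the cycle, so the displacement is the
      distance.\<close>
    have "F (int v) \<le> m" using skolem_labelling_range[OF F] by simp
    then show ?thesis
      using cycle_dist_eqI[of u "2 * m" v t "F (int v)"] uv t eq by (simp add: circle_of_def)
  qed
  have "circle_of m F \<in> {0..<2 * m} \<rightarrow>\<^sub>E {1..m}"
    using skolem_labelling_range[OF F] by (auto simp: circle_of_def)
  with card2 dist show ?thesis
    by (simp add: skolem_circles_def cycle_graph_def)
qed

text \<open>An identity between vertices extends to all integers because both labellings have period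
  2m and the symmetry respects congruence.\<close>

lemma circle_equivD:
  assumes F: "skolem_labelling m F" and G: "skolem_labelling m G"
    and eq: "(circle_of m F, circle_of m G) \<in> circle_equiv m"
  shows "\<exists>k. (\<forall>v. G v = F (k + v)) \<or> (\<forall>v. G v = F (k - v))"
proof -
  have m: "0 < m" using skolem_labelling_pos[OF F] .
  obtain k where k: "(\<forall>v<2 * m. circle_of m G v = circle_of m F (rotation (2 * m) k v)) \<or>
      (\<forall>v<2 * m. circle_of m G v = circle_of m F (reflection (2 * m) k v))"
    using eq by (auto simp: circle_equiv_def)
  have lift: "G v = F (h v)"
    if h: "\<And>u v. [u = v] (mod 2 * int m) \<Longrightarrow> [h u = h v] (mod 2 * int m)"
      and all: "\<And>v. v < 2 * m \<Longrightarrow> r v < 2 * m \<and> circle_of m G v = circle_of m F (r v)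
        \<and> [int (r v) = h (int v)] (mod 2 * int m)" for h r v
  proof -
    define w where "w = nat (v mod (2 * int m))"
    have w: "w < 2 * m" "[int w = v] (mod 2 * int m)"
      using m by (simp_all add: w_def nat_less_iff cong_def)
    have "G v = G (int w)" by (rule skolem_labelling_cong[OF G cong_sym[OF w(2)]])
    also have "\<dots> = F (int (r w))" using all[OF w(1)] w(1) by (simp add: circle_of_def)
    also have "\<dots> = F (h v)"
      by (rule skolem_labelling_cong[OF F]) (use all[OF w(1)] h[OF w(2)] in \<open>blast intro: cong_trans\<close>)
    finally show ?thesis .
  qed
  from k show ?thesis
  proof
    assume k: "\<forall>v<2 * m. circle_of m G v = circle_of m F (rotation (2 * m) k v)"
    have "G v = F (int k + v)" for v
    proof (rule lift[of "\<lambda>v. int k + v" "rotation (2 * m) k"])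
      show "rotation (2 * m) k v < 2 * m \<and> circle_of m G v = circle_of m F (rotation (2 * m) k v) \<and>
        [int (rotation (2 * m) k v) = int k + int v] (mod 2 * int m)" if "v < 2 * m" for v
        using that k by (simp add: rotation_less int_rotation cong_def add.commute)
    qed (simp add: cong_add_lcancel)
    then show ?thesis by blast
  next
    assume k: "\<forall>v<2 * m. circle_of m G v = circle_of m F (reflection (2 * m) k v)"
    have "G v = F (int k - v)" for v
    proof (rule lift[of "\<lambda>v. int k - v" "reflection (2 * m) k"])
      show "reflection (2 * m) k v < 2 * m \<and> circle_of m G v = circle_of m F (reflection (2 * m) k v) \<and>
        [int (reflection (2 * m) k v) = int k - int v] (mod 2 * int m)" if "v < 2 * m" for v
        using that k by (simp add: reflection_less int_reflection cong_def)
    qed (simp add: cong_diff)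
    then show ?thesis by blast
  qed
qed

section \<open>Mirroring parts of a labelling\<close>

text \<open>
  The function \<open>\<kappa>\<close> splits the labelling \<open>F\<close> into parts that are closed under
  \<open>v \<mapsto> - v\<close> and contain with a position the other position of the same label, so that each part
  can be mirrored independently of the others. \<open>K\<close> indexes parts that are not symmetric; they
  contain neither of the labels \<open>m\<close> and \<open>s\<close>.
\<close>

locale mirrored_parts =
  fixes m :: nat and F :: "int \<Rightarrow> nat" and \<kappa> :: "int \<Rightarrow> nat" and K :: "nat set"
    and p x :: int and s :: nat
  assumes F: "skolem_labelling m F"
    and \<kappa>_periodic: "\<And>v. \<kappa> (v + 2 * int m) = \<kappa> v"
    and \<kappa>_minus: "\<And>v. \<kappa> (- v) = \<kappa> v"
    and \<kappa>_closed: "\<And>u v. F u = F v \<Longrightarrow> \<kappa> u = \<kappa> v"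
    and finite_K: "finite K"
    and asymmetric: "\<And>i. i \<in> K \<Longrightarrow> \<exists>v. \<kappa> v = i \<and> F (- v) \<noteq> F v"
    and p: "F p = m" "F (p + int m) = m" "\<kappa> p \<notin> K"
    and x: "F x = s" "F (x + int s) = s" "\<kappa> x \<notin> K" and s: "s < m"
    and no_reflection: "\<not> [2 * x + int s = 2 * p] (mod 2 * int m)"
      "\<not> [2 * x + int s = 2 * p + int m] (mod 2 * int m)"
begin

definition mirror :: "nat set \<Rightarrow> int \<Rightarrow> nat" where
  "mirror I v = (if \<kappa> v \<in> I then F (- v) else F v)"

lemma mirror_skolem: "skolem_labelling m (mirror I)"
  unfolding skolem_labelling_def
proof (intro conjI allI ballI)
  fix v
  have "F (- (v + 2 * int m)) = F (- v)"
    by (rule skolem_labelling_cong[OF F]) (simp add: cong_iff_dvd_diff)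
  moreover have "F (v + 2 * int m) = F v"
    by (rule skolem_labelling_cong[OF F]) (simp add: cong_iff_dvd_diff)
  ultimately show "mirror I (v + 2 * int m) = mirror I v"
    by (simp add: mirror_def \<kappa>_periodic)
  show "mirror I v \<in> {1..m}"
    using skolem_labelling_range[OF F] unfolding mirror_def by simp
next
  fix s assume "s \<in> {1..m}"
  then obtain x where x: "F x = s" "F (x + int s) = s"
    using F unfolding skolem_labelling_def by blast
  then have \<kappa>: "\<kappa> (x + int s) = \<kappa> x"
    by (intro \<kappa>_closed) simp
  show "\<exists>x. mirror I x = s \<and> mirror I (x + int s) = s"
  proof (cases "\<kappa> x \<in> I")
    case True
    \<comment> \<open>Mirroring turns the pair x, x + s into -x - s, -x, so the new pair starts at
      -x - s.\<close>
    have "\<kappa> (- x - int s) = \<kappa> x" "\<kappa> (- x) = \<kappa> x"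
      using \<kappa>_minus[of "x + int s"] \<kappa>_minus[of x] \<kappa> by (simp_all add: algebra_simps)
    with True x show ?thesis
      by (intro exI[of _ "- x - int s"]) (simp add: mirror_def add.commute)
  next
    case False
    with x \<kappa> show ?thesis
      by (intro exI[of _ x]) (simp add: mirror_def)
  qed
qed

lemma mirror_inj:
  assumes "I \<subseteq> K" "J \<subseteq> K" "mirror I = mirror J"
  shows "I = J"
proof -
  have "i \<in> J" if "i \<in> I" "I \<subseteq> K" "mirror I = mirror J" for i I J
  proof -
    obtain v where v: "\<kappa> v = i" "F (- v) \<noteq> F v"
      using asymmetric \<open>i \<in> I\<close> \<open>I \<subseteq> K\<close> by blast
    have "mirror I v = mirror J v" using that by simp
    with v \<open>i \<in> I\<close> show ?thesis unfolding mirror_def by metis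
  qed
  with assms show ?thesis by (metis subsetI subset_antisym)
qed

lemma mirror_fixed: "\<kappa> v \<notin> K \<Longrightarrow> I \<subseteq> K \<Longrightarrow> mirror I v = F v"
  by (auto simp: mirror_def)

text \<open>
  A symmetry of the cycle that takes one mirrored labelling to another fixes the positions of the
  label \<open>m\<close> and those of the label \<open>s\<close>. These are not symmetric to a common axis.
\<close>

lemma mirror_equiv:
  assumes "I \<subseteq> K" "J \<subseteq> K"
    and "(circle_of m (mirror I), circle_of m (mirror J)) \<in> circle_equiv m"
  shows "mirror J = mirror I"
proof -
  let ?G = "mirror I" and ?H = "mirror J" and ?y = "x + int s"
  note G = mirror_skolem[of I]
  have \<kappa>: "\<kappa> (p + int m) \<notin> K" "\<kappa> ?y \<notin> K"
    using \<kappa>_closed[of "p + int m" p] \<kappa>_closed[of ?y x] p x by auto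
  have GH: "?G p = m" "?G (p + int m) = m" "?G x = s" "?G ?y = s" "?H p = m" "?H x = s" "?H ?y = s"
    using p x \<kappa> assms(1,2) by (simp_all add: mirror_fixed)
  have m_pos: "[u = p] (mod 2 * int m) \<or> [u = p + int m] (mod 2 * int m)" if "?G u = m" for u
    by (rule skolem_labelling_positions[OF G GH(1,2) that])
  have s_pos: "[u = x] (mod 2 * int m) \<or> [u = ?y] (mod 2 * int m)" if "?G u = s" for u
    by (rule skolem_labelling_positions[OF G GH(3,4) that])
  have "0 < s" using skolem_labelling_range[OF F, of x] x by simp
  have dvd: "\<not> 2 * int m dvd int m - int s" "\<not> 2 * int m dvd int m" "\<not> 2 * int m dvd 2 * int s"
    using \<open>0 < s\<close> s by (auto dest: zdvd_imp_le)
  obtain k where "(\<forall>v. ?H v = ?G (k + v)) \<or> (\<forall>v. ?H v = ?G (k - v))"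
    using circle_equivD[OF mirror_skolem mirror_skolem assms(3)] by blast
  then show ?thesis
  proof
    assume k: "\<forall>v. ?H v = ?G (k + v)"
    with m_pos[of "k + p"] GH have "2 * int m dvd k \<or> 2 * int m dvd k - int m"
      by (auto simp: cong_iff_dvd_diff)
    then show ?thesis
    proof
      assume "2 * int m dvd k"
      then have "?G (k + v) = ?G v" for v
        by (intro skolem_labelling_cong[OF G]) (simp add: cong_iff_dvd_diff)
      with k show ?thesis by auto
    next
      \<comment> \<open>The half turn would have to preserve the pair of \<open>s\<close>, whose
        distance lies strictly between 0 and \<open>m\<close>.\<close>
      assume km: "2 * int m dvd k - int m"
      from s_pos[of "k + x"] k GH have "2 * int m dvd k \<or> 2 * int m dvd k - int s"
        by (auto simp: cong_iff_dvd_diff)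
      then have False
      proof
        assume "2 * int m dvd k"
        from dvd_diff[OF this km] dvd(2) show False by simp
      next
        assume "2 * int m dvd k - int s"
        from dvd_diff[OF this km] dvd(1) show False by simp
      qed
      then show ?thesis ..
    qed
  next
    assume k: "\<forall>v. ?H v = ?G (k - v)"
    from m_pos[of "k - p"] k GH have kp: "2 * int m dvd k - 2 * p \<or> 2 * int m dvd k - (2 * p + int m)"
      by (auto simp: cong_iff_dvd_diff algebra_simps)
    from s_pos[of "k - x"] k GH have kx: "2 * int m dvd k - 2 * x \<or> 2 * int m dvd k - (2 * x + int s)"
      by (auto simp: cong_iff_dvd_diff algebra_simps)
    from s_pos[of "k - ?y"] k GH have ky: "2 * int m dvd k - (2 * x + 2 * int s) \<or> 2 * int m dvd k - (2 * x + int s)"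
      by (auto simp: cong_iff_dvd_diff algebra_simps)
    \<comment> \<open>The reflection either swaps the two positions of \<open>s\<close> or fixes
      both. Fixing both would make 2s divisible by 2m, against 0 < s < m.\<close>
    have kxs: "2 * int m dvd k - (2 * x + int s)"
    proof (rule ccontr)
      assume "\<not> ?thesis"
      with kx ky have "2 * int m dvd k - 2 * x" "2 * int m dvd k - (2 * x + 2 * int s)" by auto
      from dvd_diff[OF this] dvd(3) show False by simp
    qed
    from kp have "2 * int m dvd (2 * x + int s) - 2 * p \<or> 2 * int m dvd (2 * x + int s) - (2 * p + int m)"
    proof
      assume "2 * int m dvd k - 2 * p"
      from dvd_diff[OF this kxs] show ?thesis by simp
    next
      assume "2 * int m dvd k - (2 * p + int m)"
      from dvd_diff[OF this kxs] show ?thesis by (simp add: algebra_simps)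
    qed
    with no_reflection have False by (simp add: cong_iff_dvd_diff)
    then show ?thesis ..
  qed
qed

theorem num_skolem_circles_ge: "2 ^ card K \<le> num_skolem_circles m"
proof -
  define h where "h I = circle_equiv m `` {circle_of m (mirror I)}" for I
  have mem: "circle_of m (mirror I) \<in> skolem_circles m" for I
    by (rule circle_of_skolem[OF mirror_skolem])
  have "finite (\<Pi>\<^sub>E v\<in>pverts (cycle_graph (2 * m)). {1..m})"
    by (intro finite_PiE) (auto simp: cycle_graph_def)
  then have "finite (skolem_circles m)"
    by (rule rev_finite_subset) (auto simp: skolem_circles_def)
  then have fin: "finite (skolem_circles m // circle_equiv m)"
    by (rule finite_quotient) (auto simp: circle_equiv_def)
  have image: "h ` Pow K \<subseteq> skolem_circles m // circle_equiv m"
    using mem by (auto simp: h_def quotient_def)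
  have "inj_on h (Pow K)"
  proof (rule inj_onI)
    fix I J assume IJ: "I \<in> Pow K" "J \<in> Pow K" "h I = h J"
    then have "(circle_of m (mirror I), circle_of m (mirror J)) \<in> circle_equiv m"
      using eq_equiv_class[OF _ equiv_circle_equiv mem] unfolding h_def by metis
    with IJ have "mirror J = mirror I" by (intro mirror_equiv) auto
    with IJ show "I = J" by (intro mirror_inj) auto
  qed
  then have "2 ^ card K = card (h ` Pow K)"
    using finite_K by (simp add: card_image card_Pow)
  also have "\<dots> \<le> num_skolem_circles m"
    using card_mono[OF fin image] by (simp add: num_skolem_circles_def)
  finally show ?thesis .
qed

end

section \<open>Labellings from zero-sum triples\<close>

fun triple :: "nat \<times> nat \<Rightarrow> nat set" where
  "triple (a, b) = {a, b, a + b}"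

text \<open>Covering together with a count can be verified one element at a time, whereas
  disjointness would need a comparison of all pairs of triples.\<close>

definition triple_cover :: "(nat \<times> nat) set \<Rightarrow> nat set \<Rightarrow> bool" where
  "triple_cover T S \<longleftrightarrow> finite T \<and> finite S \<and> 0 \<notin> S \<and> 3 * card T \<le> card S \<and> S \<subseteq> \<Union> (triple ` T)"

lemma finite_triple: "finite (triple t)" and card_triple_le: "card (triple t) \<le> 3"
  by (cases t; simp add: card_insert_if)+

text \<open>By counting, a cover of \<open>S\<close> by at most \<open>card S / 3\<close> triples is a partition.\<close>

lemma triple_cover_partition:
  assumes "triple_cover T S"
  shows "\<Union> (triple ` T) = S" "3 * card T = card S"
    and "\<And>t. t \<in> T \<Longrightarrow> card (triple t) = 3"
    and "\<And>t u. t \<in> T \<Longrightarrow> u \<in> T \<Longrightarrow> t \<noteq> u \<Longrightarrow> triple t \<inter> triple u = {}"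
proof -
  have fin: "finite T" and sub: "S \<subseteq> \<Union> (triple ` T)" and le: "3 * card T \<le> card S"
    using assms by (auto simp: triple_cover_def)
  have finU: "finite (\<Union> (triple ` U))" if "U \<subseteq> T" for U
    using finite_subset[OF that fin] finite_triple by blast
  have cardU: "card (\<Union> (triple ` U)) \<le> 3 * card U" if "U \<subseteq> T" for U
  proof -
    have "card (\<Union> (triple ` U)) \<le> (\<Sum>t\<in>U. card (triple t))"
      by (rule card_UN_le[OF finite_subset[OF that fin]])
    also have "\<dots> \<le> (\<Sum>t\<in>U. 3)" by (intro sum_mono card_triple_le)
    finally show ?thesis by simp
  qed
  have S: "card S \<le> card (\<Union> (triple ` T))" by (rule card_mono[OF finU[OF subset_refl] sub])
  with cardU[OF subset_refl] le show eq: "3 * card T = card S" by linarith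
  show "\<Union> (triple ` T) = S"
    by (rule card_subset_eq[OF finU[OF subset_refl] sub, symmetric])
      (use S cardU[OF subset_refl] le in linarith)
  \<comment> \<open>Inclusion-exclusion for one triple against the rest. The left side is at most 3
    + 3 * (card T - 1), so the overlap is empty and the triple has three elements.\<close>
  have split: "card (triple t) + card (\<Union> (triple ` (T - {t}))) = 3 * card T +
      card (triple t \<inter> \<Union> (triple ` (T - {t})))" "Suc (card (T - {t})) = card T" if "t \<in> T" for t
  proof -
    have "\<Union> (triple ` T) = triple t \<union> \<Union> (triple ` (T - {t}))" using that by auto
    then show "card (triple t) + card (\<Union> (triple ` (T - {t}))) = 3 * card T +
        card (triple t \<inter> \<Union> (triple ` (T - {t})))"
      using card_Un_Int[OF finite_triple finU[of "T - {t}"], of t] S cardU[OF subset_refl] le by auto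
    show "Suc (card (T - {t})) = card T" using that fin by (metis card_Suc_Diff1)
  qed
  show "card (triple t) = 3" if "t \<in> T" for t
    using split[OF that] cardU[of "T - {t}"] card_triple_le[of t] by force
  show "triple t \<inter> triple u = {}" if "t \<in> T" "u \<in> T" "t \<noteq> u" for t u
  proof -
    have "card (triple t \<inter> \<Union> (triple ` (T - {t}))) = 0"
      using split[OF that(1)] cardU[of "T - {t}"] card_triple_le[of t] by force
    then have "triple t \<inter> \<Union> (triple ` (T - {t})) = {}"
      using finite_triple[of t] by simp
    with that show ?thesis by blast
  qed
qed

text \<open>The pair is ordered, and its difference is read modulo 2m so that it may straddle the
  ends of the window.\<close>

definition core_pair :: "nat \<Rightarrow> nat set \<Rightarrow> (int \<Rightarrow> nat) \<Rightarrow> int \<Rightarrow> int \<Rightarrow> nat \<Rightarrow> bool" where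
  "core_pair m S core x y s \<longleftrightarrow> {x, y} \<subseteq> {- int m<..int m} \<and> nat \<bar>x\<bar> \<notin> S \<and> nat \<bar>y\<bar> \<notin> S \<and>
     core x = s \<and> core y = s \<and> [y = x + int s] (mod 2 * int m)"

text \<open>
  A triple \<open>a + b = c\<close> occupies the positions \<open>\<plusminus>a\<close>, \<open>\<plusminus>b\<close>, \<open>\<plusminus>c\<close>: the label \<open>c\<close>
  is put on \<open>a, - b\<close>, the label \<open>a\<close> on \<open>b, c\<close> and the label \<open>b\<close> on \<open>- a, - c\<close>. The
  positions and labels outside \<open>S\<close> are matched by \<open>core\<close>.
\<close>

locale triples_and_core =
  fixes m :: nat and S :: "nat set" and T :: "(nat \<times> nat) set" and core :: "int \<Rightarrow> nat"
  assumes cover: "triple_cover T S" and S: "S \<subseteq> {1..<m}" and m: "0 < m"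
    and core_range: "\<And>w. - int m < w \<Longrightarrow> w \<le> int m \<Longrightarrow> nat \<bar>w\<bar> \<notin> S \<Longrightarrow> core w \<in> {1..m} - S"
    and core_label: "\<And>s. s \<in> {1..m} - S \<Longrightarrow> \<exists>x y. core_pair m S core x y s"
begin

definition triple_of :: "nat \<Rightarrow> nat \<times> nat" where
  "triple_of w = (THE t. t \<in> T \<and> w \<in> triple t)"

lemma triple_of_eq: "t \<in> T \<Longrightarrow> w \<in> triple t \<Longrightarrow> triple_of w = t"
  unfolding triple_of_def using triple_cover_partition(4)[OF cover] by blast

lemma triple_of: "w \<in> S \<Longrightarrow> triple_of w \<in> T \<and> w \<in> triple (triple_of w)"
  using triple_cover_partition(1)[OF cover] triple_of_eq by blast

lemma triple_subset: "t \<in> T \<Longrightarrow> triple t \<subseteq> S"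
  using triple_cover_partition(1)[OF cover] by blast

lemma triple_pos: "(a, b) \<in> T \<Longrightarrow> 0 < a \<and> 0 < b \<and> a \<noteq> b"
proof -
  assume T: "(a, b) \<in> T"
  then have "0 \<notin> {a, b, a + b}"
    using triple_subset[OF T] S by auto
  moreover have "card {a, b, a + b} = 3"
    using triple_cover_partition(3)[OF cover T] by simp
  ultimately show ?thesis by (auto simp: card_insert_if split: if_splits)
qed

lemma triple_less: "(a, b) \<in> T \<Longrightarrow> a + b < m"
  using triple_subset[of "(a, b)"] S by auto

fun triple_label :: "nat \<times> nat \<Rightarrow> int \<Rightarrow> nat" where
  "triple_label (a, b) w = (if w = int a \<or> w = - int b then a + b
     else if w = int b \<or> w = int (a + b) then a else b)"

text \<open>The shift by m - 1 makes the window contain \<open>m\<close> and not -m. Negation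
  preserves the window except at \<open>m\<close>, which is its own mirror image modulo 2m.\<close>

definition representative :: "int \<Rightarrow> int" where
  "representative v = (v + int m - 1) mod (2 * int m) - (int m - 1)"

definition label :: "int \<Rightarrow> nat" where
  "label v = (if nat \<bar>representative v\<bar> \<in> S
     then triple_label (triple_of (nat \<bar>representative v\<bar>)) (representative v)
     else core (representative v))"

text \<open>A triple is named by its first entry. The value 0 stands for the whole core and never
  names a triple, since entries of triples are positive.\<close>

definition part :: "nat \<Rightarrow> nat" where
  "part s = (if s \<in> S then fst (triple_of s) else 0)"

lemma representative_range: "- int m < representative v" "representative v \<le> int m"
proof -
  have "0 < 2 * int m" using m by simp
  from pos_mod_bound[OF this] pos_mod_sign[OF this]
  show "- int m < representative v" "representative v \<le> int m"
    unfolding representative_def by (smt (verit))+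
qed

lemma representative_eq:
  assumes "- int m < w" "w \<le> int m" "[v = w] (mod 2 * int m)"
  shows "representative v = w"
proof -
  have "(v + int m - 1) mod (2 * int m) = (w + (int m - 1)) mod (2 * int m)"
    using cong_add[OF assms(3) cong_refl[of "int m - 1"]] by (simp add: cong_def algebra_simps)
  also have "\<dots> = w + (int m - 1)" using assms by (intro mod_pos_pos_trivial) auto
  finally show ?thesis by (simp add: representative_def)
qed

lemma representative_cong: "[v = representative v] (mod 2 * int m)"
proof -
  have "[v + int m - 1 = (v + int m - 1) mod (2 * int m)] (mod 2 * int m)"
    by (simp add: cong_def)
  from cong_diff[OF this cong_refl[of "int m - 1"]] show ?thesis
    by (simp add: representative_def algebra_simps)
qed

lemma abs_representative_minus: "\<bar>representative (- v)\<bar> = \<bar>representative v\<bar>"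
proof (cases "representative v = int m")
  case True
  have "[- v = - int m] (mod 2 * int m)"
    using representative_cong[of v] True by (metis cong_minus_minus_iff)
  also have "[- int m = int m] (mod 2 * int m)" by (simp add: cong_iff_dvd_diff)
  finally show ?thesis using True representative_eq[of "int m" "- v"] m by simp
next
  case False
  have "[- v = - representative v] (mod 2 * int m)"
    using representative_cong[of v] by (metis cong_minus_minus_iff)
  then have "representative (- v) = - representative v"
    using False representative_range[of v] by (intro representative_eq) auto
  then show ?thesis by simp
qed

lemma label_core: "- int m < w \<Longrightarrow> w \<le> int m \<Longrightarrow> nat \<bar>w\<bar> \<notin> S \<Longrightarrow> label w = core w"
  by (simp add: label_def representative_eq)

lemma core_pair_label:
  assumes "core_pair m S core x y s"
  shows "label x = s \<and> label (x + int s) = s"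
proof -
  have x: "- int m < x" "x \<le> int m" "nat \<bar>x\<bar> \<notin> S" "core x = s"
    and y: "- int m < y" "y \<le> int m" "nat \<bar>y\<bar> \<notin> S" "core y = s"
    and xy: "[y = x + int s] (mod 2 * int m)"
    using assms by (simp_all add: core_pair_def)
  have "representative (x + int s) = y"
    using y(1,2) cong_sym[OF xy] by (rule representative_eq)
  with y have "label (x + int s) = s" by (simp only: label_def if_False)
  with label_core[OF x(1-3)] x(4) show ?thesis by simp
qed

lemma label_triple:
  assumes "(a, b) \<in> T"
  shows "label (int a) = a + b" "label (- int b) = a + b" "label (int b) = a"
    "label (int (a + b)) = a" "label (- int a) = b" "label (- int (a + b)) = b"
proof -
  have *: "label w = triple_label (a, b) w" if "nat \<bar>w\<bar> \<in> {a, b, a + b}" for w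
  proof -
    have "nat \<bar>w\<bar> \<in> S" using that triple_subset[OF assms] by auto
    moreover have "representative w = w"
      using that triple_less[OF assms] by (intro representative_eq) auto
    moreover have "triple_of (nat \<bar>w\<bar>) = (a, b)" using that by (intro triple_of_eq[OF assms]) simp
    ultimately show ?thesis by (simp only: label_def if_True)
  qed
  show "label (int a) = a + b" "label (- int b) = a + b" "label (int b) = a"
    "label (int (a + b)) = a" "label (- int a) = b" "label (- int (a + b)) = b"
    using *[of "int a"] *[of "- int b"] *[of "int b"] *[of "int (a + b)"] *[of "- int a"] *[of "- int (a + b)"]
      triple_pos[OF assms] by (simp_all del: of_nat_add)
qed

lemma label_in_triple:
  assumes "nat \<bar>representative v\<bar> \<in> S"
  shows "label v \<in> triple (triple_of (nat \<bar>representative v\<bar>))"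
  using assms by (cases "triple_of (nat \<bar>representative v\<bar>)") (simp add: label_def)

lemma label_not_in_S: "nat \<bar>representative v\<bar> \<notin> S \<Longrightarrow> label v \<in> {1..m} - S"
  using core_range[OF representative_range] by (simp add: label_def)

text \<open>The labels of a triple lie exactly on the positions whose absolute value belongs to it.
  So a part can be read off from the label, which makes it closed under equal labels, and from the
  absolute position, which makes it invariant under v -> -v.\<close>

lemma part_label: "part (label v) = part (nat \<bar>representative v\<bar>)"
proof (cases "nat \<bar>representative v\<bar> \<in> S")
  case True
  let ?t = "triple_of (nat \<bar>representative v\<bar>)"
  have t: "?t \<in> T" "label v \<in> triple ?t"
    using triple_of[OF True] label_in_triple[OF True] by simp_all
  then have "label v \<in> S" "triple_of (label v) = ?t"
    using triple_subset triple_of_eq by blast+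
  with True show ?thesis by (simp add: part_def)
next
  case False
  with label_not_in_S[OF this] show ?thesis by (simp add: part_def)
qed

lemma label_skolem: "skolem_labelling m label"
  unfolding skolem_labelling_def
proof (intro conjI allI ballI)
  show "label (v + 2 * int m) = label v" for v
  proof -
    have "v + 2 * int m + int m - 1 = (v + int m - 1) + 2 * int m" by simp
    then show ?thesis by (simp only: label_def representative_def mod_add_self2)
  qed
  show "label v \<in> {1..m}" for v
  proof (cases "nat \<bar>representative v\<bar> \<in> S")
    case True
    have "label v \<in> S"
      using label_in_triple[OF True] triple_of[OF True] triple_subset by blast
    with S show ?thesis by auto
  qed (use label_not_in_S in blast)
  fix s assume s: "s \<in> {1..m}"
  show "\<exists>x. label x = s \<and> label (x + int s) = s"
  proof (cases "s \<in> S")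
    case True
    obtain a b where ab: "triple_of s = (a, b)" by (cases "triple_of s")
    with triple_of[OF True] have T: "(a, b) \<in> T" and "s \<in> {a, b, a + b}" by auto
    then consider "s = a" | "s = b" | "s = a + b" by blast
    then show ?thesis
    proof cases
      case 1
      then show ?thesis using label_triple(3,4)[OF T] by (intro exI[of _ "int b"]) (simp add: add.commute)
    next
      case 2
      then show ?thesis using label_triple(5,6)[OF T] by (intro exI[of _ "- int (a + b)"]) simp
    next
      case 3
      then show ?thesis using label_triple(1,2)[OF T] by (intro exI[of _ "- int b"]) simp
    qed
  next
    case False
    with s obtain x y where "core_pair m S core x y s" using core_label by blast
    with core_pair_label show ?thesis by blast
  qed
qed

lemma part_m: "part m = 0"
  using S by (auto simp: part_def)

lemma zero_notin_fst: "0 \<notin> fst ` T"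
  using triple_pos by fastforce

text \<open>No triple is symmetric: with first entry \<open>i\<close> and second entry
  \<open>b\<close>, position i carries i + b but position -i carries b.\<close>

lemma mirrored_parts:
  assumes K: "K \<subseteq> fst ` T"
    and p: "label p = m" "label (p + int m) = m"
    and x: "label x = s" "label (x + int s) = s" "part s \<notin> K" "s < m"
    and "\<not> [2 * x + int s = 2 * p] (mod 2 * int m)"
      "\<not> [2 * x + int s = 2 * p + int m] (mod 2 * int m)"
  shows "mirrored_parts m label (\<lambda>v. part (label v)) K p x s"
proof
  show "part (label (v + 2 * int m)) = part (label v)" for v
    using skolem_labelling_cong[OF label_skolem, of "v + 2 * int m" v] by (simp add: cong_iff_dvd_diff)
  show "part (label (- v)) = part (label v)" for v
    by (simp add: part_label abs_representative_minus)
  show "finite K"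
    using K cover by (auto simp: triple_cover_def intro: finite_subset)
  show "\<exists>v. part (label v) = i \<and> label (- v) \<noteq> label v" if "i \<in> K" for i
  proof -
    from that K obtain b where T: "(i, b) \<in> T" by auto
    have "part (label (int i)) = i"
      using triple_of_eq[OF T, of "i + b"] triple_subset[OF T] by (simp add: label_triple(1)[OF T] part_def)
    moreover have "label (- int i) \<noteq> label (int i)"
      using label_triple[OF T] triple_pos[OF T] by simp
    ultimately show ?thesis by blast
  qed
  show "part (label p) \<notin> K" "part (label x) \<notin> K"
    using K zero_notin_fst x(1,3) by (auto simp: p part_m)
  show "skolem_labelling m label" by (rule label_skolem)
  show "part (label u) = part (label v)" if "label u = label v" for u v
    using that by (rule arg_cong)
qed fact+

lemma inj_on_fst: "inj_on fst T"
proof (rule inj_onI)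
  fix t u assume "t \<in> T" "u \<in> T" "fst t = fst u"
  then show "t = u"
    using triple_of_eq[of t "fst t"] triple_of_eq[of u "fst u"] by (cases t; cases u) auto
qed

text \<open>When the core offers no second label, one triple is kept unmirrored and its label a + b
  on -b and a plays that part; this costs one factor 2. Here 2 * (-b) + (a + b) = a - b is congruent
  to neither 0 nor \<open>m\<close>, since 0 < |a - b| < m.\<close>

lemma num_skolem_circles_ge_triples:
  assumes "T \<noteq> {}" and "core 0 = m" "core (int m) = m"
  shows "2 ^ (card T - 1) \<le> num_skolem_circles m"
proof -
  obtain a b where T: "(a, b) \<in> T" using assms(1) by auto
  note pos = triple_pos[OF T] and less = triple_less[OF T]
  have fin: "finite T" using cover by (simp add: triple_cover_def)
  have "m \<notin> S" "0 \<notin> S" using S by auto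
  then have m_label: "label 0 = m" "label (0 + int m) = m"
    using label_core assms m by simp_all
  have part: "part (a + b) = a"
    using triple_of_eq[OF T, of "a + b"] triple_subset[OF T] by (simp add: part_def)
  have "\<not> 2 * int m dvd int a - int b" "\<not> 2 * int m dvd int b + int m - int a"
    using pos less zdvd_imp_le[of "2 * int m" "int a - int b"] zdvd_imp_le[of "2 * int m" "int b - int a"]
      zdvd_imp_le[of "2 * int m" "int b + int m - int a"] dvd_diff_commute[of "2 * int m" "int a" "int b"]
    by (cases "a < b"; force)+
  then have "mirrored_parts m label (\<lambda>v. part (label v)) (fst ` T - {a}) 0 (- int b) (a + b)"
    using m_label part less label_triple[OF T]
    by (intro mirrored_parts) (auto simp: cong_iff_dvd_diff dvd_diff_commute algebra_simps)
  then have "2 ^ card (fst ` T - {a}) \<le> num_skolem_circles m"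
    by (rule mirrored_parts.num_skolem_circles_ge)
  moreover have "a \<in> fst ` T" using T by force
  ultimately show ?thesis using fin by (simp add: card_image[OF inj_on_fst])
qed

lemma num_skolem_circles_ge_core:
  assumes p: "core_pair m S core p q m" and x: "core_pair m S core x y s" and "s < m"
    and "\<not> [2 * x + int s = 2 * p] (mod 2 * int m)"
      "\<not> [2 * x + int s = 2 * p + int m] (mod 2 * int m)"
  shows "2 ^ card T \<le> num_skolem_circles m"
proof -
  have "s \<notin> S"
    using x core_range[of x] by (auto simp: core_pair_def)
  then have "part s \<notin> fst ` T" using zero_notin_fst by (simp add: part_def)
  then have "mirrored_parts m label (\<lambda>v. part (label v)) (fst ` T) p x s"
    using core_pair_label[OF p] core_pair_label[OF x] assms(3-5) by (intro mirrored_parts) auto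
  then have "2 ^ card (fst ` T) \<le> num_skolem_circles m"
    by (rule mirrored_parts.num_skolem_circles_ge)
  then show ?thesis by (simp add: card_image[OF inj_on_fst])
qed

end

section \<open>Partitions into triples\<close>

text \<open>
  In a Langford sequence with smallest label \<open>d\<close> and largest label \<open>N\<close>, a label \<open>i\<close> on the
  positions \<open>x\<close> and \<open>x + i\<close> gives the triple \<open>i, N + x, N + x + i\<close>. Nested pairs of
  positions have the same sum, so that \<open>a + 2 * b\<close> is constant on the resulting triples.
\<close>

definition triple_run :: "nat \<times> nat \<times> nat \<Rightarrow> (nat \<times> nat) set" where
  "triple_run = (\<lambda>(B, l, C). {(a, b). B \<le> b \<and> b < B + l \<and> a + 2 * b = C})"

definition triples :: "(nat \<times> nat \<times> nat) list \<Rightarrow> (nat \<times> nat) list \<Rightarrow> (nat \<times> nat) set" where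
  "triples rs ts = (\<Union>r\<in>set rs. triple_run r) \<union> set ts"

fun run_covers :: "nat \<Rightarrow> nat \<times> nat \<times> nat \<Rightarrow> bool" where
  "run_covers w (B, l, C) \<longleftrightarrow> B \<le> w \<and> w < B + l \<or> w + B \<le> C \<and> C < w + B + l \<or>
     even (w + C) \<and> w + 2 * B \<le> C \<and> C < w + 2 * (B + l)"

lemma triple_run_card: "finite (triple_run (B, l, C))" "card (triple_run (B, l, C)) \<le> l"
proof -
  have sub: "triple_run (B, l, C) \<subseteq> (\<lambda>b. (C - 2 * b, b)) ` {B..<B + l}"
    by (auto simp: triple_run_def image_iff)
  then show "finite (triple_run (B, l, C))" by (rule finite_subset) simp
  have "card (triple_run (B, l, C)) \<le> card ((\<lambda>b. (C - 2 * b, b)) ` {B..<B + l})"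
    by (rule card_mono[OF _ sub]) simp
  also have "\<dots> \<le> l" using card_image_le[of "{B..<B + l}" "\<lambda>b. (C - 2 * b, b)"] by simp
  finally show "card (triple_run (B, l, C)) \<le> l" .
qed

text \<open>The bound on \<open>C\<close> means that 2b \<le> C even for the last b = B + l - 1, so
  a = C - 2b is never truncated.\<close>

lemma run_covers:
  assumes "run_covers w (B, l, C)" "2 * (B + l) \<le> C + 2"
  shows "\<exists>t\<in>triple_run (B, l, C). w \<in> triple t"
proof -
  from assms(1) consider "B \<le> w \<and> w < B + l" | "w + B \<le> C \<and> C < w + B + l"
    | "even (w + C) \<and> w + 2 * B \<le> C \<and> C < w + 2 * (B + l)"
    by auto
  then obtain a b where ab: "B \<le> b" "b < B + l" "a + 2 * b = C" "w = a \<or> w = b \<or> w = a + b"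
  proof cases
    case 1
    then show ?thesis using assms(2) that[of w "C - 2 * w"] by auto
  next
    case 2
    then obtain b where "C = w + b" by (metis add_leD1 le_Suc_ex)
    with 2 assms(2) show ?thesis using that[of b "w - b"] by auto
  next
    case 3
    then have "even (C - w)" "w \<le> C" by auto
    then obtain b where "C = w + 2 * b" by (metis evenE le_add_diff_inverse)
    with 3 show ?thesis using that[of b w] by auto
  qed
  then show ?thesis
    by (intro bexI[of _ "(a, b)"]) (auto simp: triple_run_def)
qed

text \<open>The lengths of the runs bound the number of triples, so no overlap has to be examined
  and only the coverage of \<open>S\<close> requires work.\<close>

lemma triple_coverI:
  assumes "finite S" "0 \<notin> S" "3 * (sum_list (map (fst \<circ> snd) rs) + length ts) \<le> card S"
    and runs: "\<forall>(B, l, C) \<in> set rs. 2 * (B + l) \<le> C + 2"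
    and covers: "\<And>w. w \<in> S \<Longrightarrow> list_ex (run_covers w) rs \<or> list_ex (\<lambda>(a, b). w = a \<or> w = b \<or> w = a + b) ts"
  shows "triple_cover (triples rs ts) S"
proof -
  have "finite (\<Union>r\<in>set rs. triple_run r) \<and> card (\<Union>r\<in>set rs. triple_run r) \<le> sum_list (map (fst \<circ> snd) rs)"
  proof (induction rs)
    case (Cons r rs)
    obtain B l C where r: "r = (B, l, C)" by (cases r)
    with Cons triple_run_card[of B l C] show ?case
      using card_Un_le[of "triple_run r" "\<Union>r\<in>set rs. triple_run r"] by auto
  qed simp
  then have "finite (triples rs ts)" "card (triples rs ts) \<le> sum_list (map (fst \<circ> snd) rs) + length ts"
    using card_Un_le[of "\<Union>r\<in>set rs. triple_run r" "set ts"] card_length[of ts]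
    by (auto simp: triples_def)
  moreover have "w \<in> \<Union> (triple ` triples rs ts)" if "w \<in> S" for w
    using covers[OF that]
  proof
    assume "list_ex (run_covers w) rs"
    then obtain B l C where "(B, l, C) \<in> set rs" "run_covers w (B, l, C)"
      by (auto simp: list_ex_iff)
    moreover from this runs have "2 * (B + l) \<le> C + 2" by auto
    ultimately show ?thesis
      using run_covers[of w B l C] by (fastforce simp: triples_def)
  next
    assume "list_ex (\<lambda>(a, b). w = a \<or> w = b \<or> w = a + b) ts"
    then show ?thesis by (fastforce simp: list_ex_iff triples_def)
  qed
  ultimately show ?thesis
    using assms(1-3) unfolding triple_cover_def by (auto intro: order_trans)
qed

text \<open>The constants come from a computer search for few nests of pairs and boundedly many other pairs.\<close>

lemma skolem_cover_0:
  "triple_cover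
    (triples [(8 * t + 16, 2 * t + 4, 20 * t + 40), (4 * t + 9, t, 12 * t + 23),
      (5 * t + 12, t, 12 * t + 25)]
      [(2 * t + 5, 5 * t + 9), (1, 5 * t + 10), (2 * t + 3, 6 * t + 12),
      (4 * t + 7, 6 * t + 13)])
    {1..12 * t + 24}"
proof (rule triple_coverI, goal_cases)
  case (5 w)
  \<comment> \<open>Up to 4t + 8, the largest label of the Skolem sequence, \<open>w\<close> is a
    label; its parity narrows down the nests, as a = C - 2b has the parity of C. Above that it is a
    position. The ranges below break where the covering run, pair or entry changes.\<close>
  consider k where "w = 2 * k" "w \<le> 4 * t + 8" | k where "w = 2 * k + 1" "w \<le> 4 * t + 8" | "4 * t + 8 < w"
    by (metis evenE oddE not_le)
  then show ?case
  proof cases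
    case (1 k)
    then show ?thesis using 5 by (simp; presburger)+
  next
    case (2 k)
    consider "k < 1" | "\<not> k < 1 \<and> k < t + 1" | "\<not> k < t + 1 \<and> k < t + 2"
      | "\<not> k < t + 2 \<and> k < t + 3" | "\<not> k < t + 3 \<and> k < 2 * t + 3"
      | "\<not> k < 2 * t + 3"
      by blast
    then show ?thesis using 2 5 by cases (simp; presburger)+
  next
    case 3
    consider "w < 5 * t + 9" | "\<not> w < 5 * t + 9 \<and> w < 5 * t + 10"
      | "\<not> w < 5 * t + 10 \<and> w < 5 * t + 11"
      | "\<not> w < 5 * t + 11 \<and> w < 5 * t + 12"
      | "\<not> w < 5 * t + 12 \<and> w < 6 * t + 12"
      | "\<not> w < 6 * t + 12 \<and> w < 6 * t + 13"
      | "\<not> w < 6 * t + 13 \<and> w < 6 * t + 14"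
      | "\<not> w < 6 * t + 14 \<and> w < 7 * t + 14"
      | "\<not> w < 7 * t + 14 \<and> w < 7 * t + 15"
      | "\<not> w < 7 * t + 15 \<and> w < 8 * t + 15"
      | "\<not> w < 8 * t + 15 \<and> w < 8 * t + 16"
      | "\<not> w < 8 * t + 16 \<and> w < 10 * t + 20"
      | "\<not> w < 10 * t + 20 \<and> w < 10 * t + 21" | "\<not> w < 10 * t + 21"
      by blast
    then show ?thesis using 3 5 by cases (simp; presburger)+
  qed
qed simp_all

lemma skolem_cover_1:
  "triple_cover
    (triples [(8 * t + 19, 2 * t + 4, 20 * t + 46), (4 * t + 10, t + 2, 12 * t + 27),
      (5 * t + 14, t, 12 * t + 29)]
      [(1, 5 * t + 12), (4 * t + 9, 6 * t + 14), (2 * t + 3, 6 * t + 15)])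
    {1..12 * t + 27}"
proof (rule triple_coverI, goal_cases)
  case (5 w)
  consider k where "w = 2 * k" "w \<le> 4 * t + 9" | k where "w = 2 * k + 1" "w \<le> 4 * t + 9" | "4 * t + 9 < w"
    by (metis evenE oddE not_le)
  then show ?case
  proof cases
    case (1 k)
    then show ?thesis using 5 by (simp; presburger)+
  next
    case (2 k)
    consider "k < 1" | "\<not> k < 1 \<and> k < t + 1" | "\<not> k < t + 1 \<and> k < t + 2"
      | "\<not> k < t + 2 \<and> k < 2 * t + 4" | "\<not> k < 2 * t + 4"
      by blast
    then show ?thesis using 2 5 by cases (simp; presburger)+
  next
    case 3
    consider "w < 5 * t + 12" | "\<not> w < 5 * t + 12 \<and> w < 5 * t + 13"
      | "\<not> w < 5 * t + 13 \<and> w < 5 * t + 14"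
      | "\<not> w < 5 * t + 14 \<and> w < 6 * t + 14"
      | "\<not> w < 6 * t + 14 \<and> w < 6 * t + 15"
      | "\<not> w < 6 * t + 15 \<and> w < 6 * t + 16"
      | "\<not> w < 6 * t + 16 \<and> w < 7 * t + 16"
      | "\<not> w < 7 * t + 16 \<and> w < 8 * t + 18"
      | "\<not> w < 8 * t + 18 \<and> w < 8 * t + 19"
      | "\<not> w < 8 * t + 19 \<and> w < 10 * t + 23"
      | "\<not> w < 10 * t + 23 \<and> w < 10 * t + 24" | "\<not> w < 10 * t + 24"
      by blast
    then show ?thesis using 3 5 by cases (simp; presburger)+
  qed
qed simp_all

text \<open>The labels are 3, ..., 4t + 22. The nests account for 4t + 6 of them, of one parity
  within each nest, and the single pairs for the other 14.\<close>

lemma langford_cover_0: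
  "triple_cover
    (triples [(8 * t + 49, 2 * t + 4, 20 * t + 111), (4 * t + 24, t + 2, 12 * t + 70),
      (5 * t + 35, t, 12 * t + 76)]
      [(2 * t + 18, 4 * t + 23), (2 * t + 16, 5 * t + 26), (6, 5 * t + 27), (4, 5 * t + 28),
      (5, 5 * t + 29), (2 * t + 14, 5 * t + 30), (2 * t + 12, 5 * t + 31),
      (4 * t + 21, 6 * t + 35), (4 * t + 17, 6 * t + 36), (3, 6 * t + 37),
      (4 * t + 19, 6 * t + 38), (4 * t + 15, 6 * t + 39), (2 * t + 8, 8 * t + 47),
      (2 * t + 10, 8 * t + 48)])
    {3..12 * t + 62}"
proof (rule triple_coverI, goal_cases)
  case (5 w)
  consider k where "w = 2 * k" "w \<le> 4 * t + 22" | k where "w = 2 * k + 1" "w \<le> 4 * t + 22" | "4 * t + 22 < w"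
    by (metis evenE oddE not_le)
  then show ?case
  proof cases
    case (1 k)
    consider "k < 3" | "\<not> k < 3 \<and> k < 4" | "\<not> k < 4 \<and> k < t + 4"
      | "\<not> k < t + 4 \<and> k < t + 5" | "\<not> k < t + 5 \<and> k < t + 6"
      | "\<not> k < t + 6 \<and> k < t + 7" | "\<not> k < t + 7 \<and> k < t + 8"
      | "\<not> k < t + 8 \<and> k < t + 9" | "\<not> k < t + 9 \<and> k < t + 10"
      | "\<not> k < t + 10"
      by blast
    then show ?thesis using 1 5 by cases (simp; presburger)+
  next
    case (2 k)
    consider "k < 2" | "\<not> k < 2 \<and> k < 3" | "\<not> k < 3 \<and> k < 2 * t + 7"
      | "\<not> k < 2 * t + 7 \<and> k < 2 * t + 8" | "\<not> k < 2 * t + 8 \<and> k < 2 * t + 9"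
      | "\<not> k < 2 * t + 9 \<and> k < 2 * t + 10" | "\<not> k < 2 * t + 10"
      by blast
    then show ?thesis using 2 5 by cases (simp; presburger)+
  next
    case 3
    consider "w < 4 * t + 24" | "\<not> w < 4 * t + 24 \<and> w < 5 * t + 26"
      | "\<not> w < 5 * t + 26 \<and> w < 5 * t + 27"
      | "\<not> w < 5 * t + 27 \<and> w < 5 * t + 28"
      | "\<not> w < 5 * t + 28 \<and> w < 5 * t + 29"
      | "\<not> w < 5 * t + 29 \<and> w < 5 * t + 30"
      | "\<not> w < 5 * t + 30 \<and> w < 5 * t + 31"
      | "\<not> w < 5 * t + 31 \<and> w < 5 * t + 32"
      | "\<not> w < 5 * t + 32 \<and> w < 5 * t + 33"
      | "\<not> w < 5 * t + 33 \<and> w < 5 * t + 34"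
      | "\<not> w < 5 * t + 34 \<and> w < 5 * t + 35"
      | "\<not> w < 5 * t + 35 \<and> w < 6 * t + 35"
      | "\<not> w < 6 * t + 35 \<and> w < 6 * t + 36"
      | "\<not> w < 6 * t + 36 \<and> w < 6 * t + 37"
      | "\<not> w < 6 * t + 37 \<and> w < 6 * t + 38"
      | "\<not> w < 6 * t + 38 \<and> w < 6 * t + 39"
      | "\<not> w < 6 * t + 39 \<and> w < 6 * t + 40"
      | "\<not> w < 6 * t + 40 \<and> w < 6 * t + 41"
      | "\<not> w < 6 * t + 41 \<and> w < 6 * t + 42"
      | "\<not> w < 6 * t + 42 \<and> w < 7 * t + 42"
      | "\<not> w < 7 * t + 42 \<and> w < 7 * t + 43"
      | "\<not> w < 7 * t + 43 \<and> w < 7 * t + 44"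
      | "\<not> w < 7 * t + 44 \<and> w < 7 * t + 45"
      | "\<not> w < 7 * t + 45 \<and> w < 8 * t + 47"
      | "\<not> w < 8 * t + 47 \<and> w < 8 * t + 48"
      | "\<not> w < 8 * t + 48 \<and> w < 8 * t + 49"
      | "\<not> w < 8 * t + 49 \<and> w < 10 * t + 53"
      | "\<not> w < 10 * t + 53 \<and> w < 10 * t + 54"
      | "\<not> w < 10 * t + 54 \<and> w < 10 * t + 55"
      | "\<not> w < 10 * t + 55 \<and> w < 10 * t + 56"
      | "\<not> w < 10 * t + 56 \<and> w < 10 * t + 57"
      | "\<not> w < 10 * t + 57 \<and> w < 10 * t + 58"
      | "\<not> w < 10 * t + 58 \<and> w < 10 * t + 59" | "\<not> w < 10 * t + 59"
      by blast
    then show ?thesis using 3 5 by cases (simp; presburger)+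
  qed
qed simp_all

lemma langford_cover_1:
  "triple_cover
    (triples [(8 * t + 50, 2 * t + 4, 20 * t + 114), (4 * t + 24, t, 12 * t + 67),
      (5 * t + 34, t, 12 * t + 73)]
      [(2 * t + 19, 5 * t + 24), (2 * t + 17, 5 * t + 25), (6, 5 * t + 26),
      (2 * t + 13, 5 * t + 27), (3, 5 * t + 28), (4, 5 * t + 29),
      (2 * t + 11, 5 * t + 30), (4 * t + 22, 6 * t + 34), (4 * t + 20, 6 * t + 35),
      (4 * t + 23, 6 * t + 36), (4 * t + 21, 6 * t + 37), (4 * t + 16, 6 * t + 38),
      (2 * t + 7, 6 * t + 39), (5, 8 * t + 44), (2 * t + 15, 8 * t + 45),
      (4 * t + 18, 8 * t + 47), (2 * t + 9, 8 * t + 48)])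
    {3..12 * t + 65}"
proof (rule triple_coverI, goal_cases)
  case (5 w)
  consider k where "w = 2 * k" "w \<le> 4 * t + 23" | k where "w = 2 * k + 1" "w \<le> 4 * t + 23" | "4 * t + 23 < w"
    by (metis evenE oddE not_le)
  then show ?case
  proof cases
    case (1 k)
    consider "k < 3" | "\<not> k < 3 \<and> k < 4" | "\<not> k < 4 \<and> k < 2 * t + 8"
      | "\<not> k < 2 * t + 8 \<and> k < 2 * t + 9" | "\<not> k < 2 * t + 9 \<and> k < 2 * t + 10"
      | "\<not> k < 2 * t + 10 \<and> k < 2 * t + 11" | "\<not> k < 2 * t + 11"
      by blast
    then show ?thesis using 1 5 by cases (simp; presburger)+
  next
    case (2 k)
    consider "k < 2" | "\<not> k < 2 \<and> k < 3" | "\<not> k < 3 \<and> k < t + 3"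
      | "\<not> k < t + 3 \<and> k < t + 4" | "\<not> k < t + 4 \<and> k < t + 5"
      | "\<not> k < t + 5 \<and> k < t + 6" | "\<not> k < t + 6 \<and> k < t + 7"
      | "\<not> k < t + 7 \<and> k < t + 8" | "\<not> k < t + 8 \<and> k < t + 9"
      | "\<not> k < t + 9 \<and> k < t + 10" | "\<not> k < t + 10 \<and> k < 2 * t + 10"
      | "\<not> k < 2 * t + 10 \<and> k < 2 * t + 11" | "\<not> k < 2 * t + 11"
      by blast
    then show ?thesis using 2 5 by cases (simp; presburger)+
  next
    case 3
    consider "w < 5 * t + 24" | "\<not> w < 5 * t + 24 \<and> w < 5 * t + 25"
      | "\<not> w < 5 * t + 25 \<and> w < 5 * t + 26"
      | "\<not> w < 5 * t + 26 \<and> w < 5 * t + 27"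
      | "\<not> w < 5 * t + 27 \<and> w < 5 * t + 28"
      | "\<not> w < 5 * t + 28 \<and> w < 5 * t + 29"
      | "\<not> w < 5 * t + 29 \<and> w < 5 * t + 30"
      | "\<not> w < 5 * t + 30 \<and> w < 5 * t + 31"
      | "\<not> w < 5 * t + 31 \<and> w < 5 * t + 32"
      | "\<not> w < 5 * t + 32 \<and> w < 5 * t + 33"
      | "\<not> w < 5 * t + 33 \<and> w < 5 * t + 34"
      | "\<not> w < 5 * t + 34 \<and> w < 6 * t + 34"
      | "\<not> w < 6 * t + 34 \<and> w < 6 * t + 35"
      | "\<not> w < 6 * t + 35 \<and> w < 6 * t + 36"
      | "\<not> w < 6 * t + 36 \<and> w < 6 * t + 37"
      | "\<not> w < 6 * t + 37 \<and> w < 6 * t + 38"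
      | "\<not> w < 6 * t + 38 \<and> w < 6 * t + 39"
      | "\<not> w < 6 * t + 39 \<and> w < 6 * t + 40"
      | "\<not> w < 6 * t + 40 \<and> w < 7 * t + 40"
      | "\<not> w < 7 * t + 40 \<and> w < 7 * t + 41"
      | "\<not> w < 7 * t + 41 \<and> w < 7 * t + 42"
      | "\<not> w < 7 * t + 42 \<and> w < 7 * t + 43"
      | "\<not> w < 7 * t + 43 \<and> w < 7 * t + 44"
      | "\<not> w < 7 * t + 44 \<and> w < 8 * t + 44"
      | "\<not> w < 8 * t + 44 \<and> w < 8 * t + 45"
      | "\<not> w < 8 * t + 45 \<and> w < 8 * t + 46"
      | "\<not> w < 8 * t + 46 \<and> w < 8 * t + 47"
      | "\<not> w < 8 * t + 47 \<and> w < 8 * t + 48"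
      | "\<not> w < 8 * t + 48 \<and> w < 8 * t + 49"
      | "\<not> w < 8 * t + 49 \<and> w < 8 * t + 50"
      | "\<not> w < 8 * t + 50 \<and> w < 10 * t + 54"
      | "\<not> w < 10 * t + 54 \<and> w < 10 * t + 55"
      | "\<not> w < 10 * t + 55 \<and> w < 10 * t + 56"
      | "\<not> w < 10 * t + 56 \<and> w < 10 * t + 57"
      | "\<not> w < 10 * t + 57 \<and> w < 10 * t + 58"
      | "\<not> w < 10 * t + 58 \<and> w < 10 * t + 59"
      | "\<not> w < 10 * t + 59 \<and> w < 10 * t + 60"
      | "\<not> w < 10 * t + 60 \<and> w < 10 * t + 61"
      | "\<not> w < 10 * t + 61 \<and> w < 12 * t + 65" | "\<not> w < 12 * t + 65"
      by blast
    then show ?thesis using 3 5 by cases (simp; presburger)+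
  qed
qed simp_all

text \<open>The labels end at 4t + 19, so the missing element is a vacant position of the sequence;
  8t + 38 is 2m/3 for m = 12t + 57.\<close>

lemma holed_cover_1:
  "triple_cover
    (triples [(8 * t + 40, 2 * t + 4, 20 * t + 94), (4 * t + 21, t, 12 * t + 55),
      (5 * t + 29, t, 12 * t + 61)]
      [(4 * t + 17, 4 * t + 20), (3, 5 * t + 21), (6, 5 * t + 22), (4, 5 * t + 23),
      (2 * t + 9, 5 * t + 25), (2 * t + 7, 5 * t + 26), (4 * t + 16, 6 * t + 29),
      (4 * t + 19, 6 * t + 30), (4 * t + 15, 6 * t + 31), (4 * t + 18, 6 * t + 32),
      (2 * t + 13, 8 * t + 35), (2 * t + 11, 8 * t + 36), (2 * t + 5, 8 * t + 39)])
    ({3..12 * t + 54} - {8 * t + 38})"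
proof (rule triple_coverI, goal_cases)
  case (5 w)
  consider k where "w = 2 * k" "w \<le> 4 * t + 19" | k where "w = 2 * k + 1" "w \<le> 4 * t + 19" | "4 * t + 19 < w"
    by (metis evenE oddE not_le)
  then show ?case
  proof cases
    case (1 k)
    consider "k < 3" | "\<not> k < 3 \<and> k < 4" | "\<not> k < 4 \<and> k < 2 * t + 8"
      | "\<not> k < 2 * t + 8 \<and> k < 2 * t + 9" | "\<not> k < 2 * t + 9"
      by blast
    then show ?thesis using 1 5 by cases (simp; presburger)+
  next
    case (2 k)
    consider "k < 2" | "\<not> k < 2 \<and> k < t + 2" | "\<not> k < t + 2 \<and> k < t + 3"
      | "\<not> k < t + 3 \<and> k < t + 4" | "\<not> k < t + 4 \<and> k < t + 5"
      | "\<not> k < t + 5 \<and> k < t + 6" | "\<not> k < t + 6 \<and> k < t + 7"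
      | "\<not> k < t + 7 \<and> k < 2 * t + 7" | "\<not> k < 2 * t + 7 \<and> k < 2 * t + 8"
      | "\<not> k < 2 * t + 8 \<and> k < 2 * t + 9" | "\<not> k < 2 * t + 9"
      by blast
    then show ?thesis using 2 5 by cases (simp; presburger)+
  next
    case 3
    consider "w < 4 * t + 21" | "\<not> w < 4 * t + 21 \<and> w < 5 * t + 21"
      | "\<not> w < 5 * t + 21 \<and> w < 5 * t + 22"
      | "\<not> w < 5 * t + 22 \<and> w < 5 * t + 23"
      | "\<not> w < 5 * t + 23 \<and> w < 5 * t + 24"
      | "\<not> w < 5 * t + 24 \<and> w < 5 * t + 25"
      | "\<not> w < 5 * t + 25 \<and> w < 5 * t + 26"
      | "\<not> w < 5 * t + 26 \<and> w < 5 * t + 27"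
      | "\<not> w < 5 * t + 27 \<and> w < 5 * t + 28"
      | "\<not> w < 5 * t + 28 \<and> w < 5 * t + 29"
      | "\<not> w < 5 * t + 29 \<and> w < 6 * t + 29"
      | "\<not> w < 6 * t + 29 \<and> w < 6 * t + 30"
      | "\<not> w < 6 * t + 30 \<and> w < 6 * t + 31"
      | "\<not> w < 6 * t + 31 \<and> w < 6 * t + 32"
      | "\<not> w < 6 * t + 32 \<and> w < 6 * t + 33"
      | "\<not> w < 6 * t + 33 \<and> w < 7 * t + 33"
      | "\<not> w < 7 * t + 33 \<and> w < 7 * t + 34"
      | "\<not> w < 7 * t + 34 \<and> w < 7 * t + 35"
      | "\<not> w < 7 * t + 35 \<and> w < 8 * t + 35"
      | "\<not> w < 8 * t + 35 \<and> w < 8 * t + 36"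
      | "\<not> w < 8 * t + 36 \<and> w < 8 * t + 37"
      | "\<not> w < 8 * t + 37 \<and> w < 8 * t + 38"
      | "\<not> w < 8 * t + 38 \<and> w < 8 * t + 39"
      | "\<not> w < 8 * t + 39 \<and> w < 8 * t + 40"
      | "\<not> w < 8 * t + 40 \<and> w < 10 * t + 44"
      | "\<not> w < 10 * t + 44 \<and> w < 10 * t + 45"
      | "\<not> w < 10 * t + 45 \<and> w < 10 * t + 46"
      | "\<not> w < 10 * t + 46 \<and> w < 10 * t + 47"
      | "\<not> w < 10 * t + 47 \<and> w < 10 * t + 48"
      | "\<not> w < 10 * t + 48 \<and> w < 10 * t + 49"
      | "\<not> w < 10 * t + 49 \<and> w < 10 * t + 50"
      | "\<not> w < 10 * t + 50 \<and> w < 10 * t + 51" | "\<not> w < 10 * t + 51"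
      by blast
    then show ?thesis using 3 5 by cases (simp; presburger)+
  qed
qed simp_all

lemma holed_cover_2:
  "triple_cover
    (triples [(8 * t + 42, 2 * t + 4, 20 * t + 98), (4 * t + 21, t + 1, 12 * t + 57),
      (5 * t + 30, t, 12 * t + 63)]
      [(4, 5 * t + 22), (6, 5 * t + 23), (3, 5 * t + 24), (2 * t + 9, 5 * t + 25),
      (2 * t + 7, 5 * t + 28), (4 * t + 19, 6 * t + 30), (4 * t + 16, 6 * t + 31),
      (4 * t + 20, 6 * t + 32), (4 * t + 17, 6 * t + 33), (2 * t + 11, 8 * t + 37),
      (2 * t + 13, 8 * t + 38), (4 * t + 18, 8 * t + 39), (2 * t + 5, 8 * t + 41)])
    ({3..12 * t + 57} - {8 * t + 40})"
proof (rule triple_coverI, goal_cases)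
  case (5 w)
  consider k where "w = 2 * k" "w \<le> 4 * t + 20" | k where "w = 2 * k + 1" "w \<le> 4 * t + 20" | "4 * t + 20 < w"
    by (metis evenE oddE not_le)
  then show ?case
  proof cases
    case (1 k)
    consider "k < 3" | "\<not> k < 3 \<and> k < 4" | "\<not> k < 4 \<and> k < 2 * t + 8"
      | "\<not> k < 2 * t + 8 \<and> k < 2 * t + 9" | "\<not> k < 2 * t + 9 \<and> k < 2 * t + 10"
      | "\<not> k < 2 * t + 10"
      by blast
    then show ?thesis using 1 5 by cases (simp; presburger)+
  next
    case (2 k)
    consider "k < 2" | "\<not> k < 2 \<and> k < t + 2" | "\<not> k < t + 2 \<and> k < t + 3"
      | "\<not> k < t + 3 \<and> k < t + 4" | "\<not> k < t + 4 \<and> k < t + 5"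
      | "\<not> k < t + 5 \<and> k < t + 6" | "\<not> k < t + 6 \<and> k < t + 7"
      | "\<not> k < t + 7 \<and> k < 2 * t + 8" | "\<not> k < 2 * t + 8 \<and> k < 2 * t + 9"
      | "\<not> k < 2 * t + 9"
      by blast
    then show ?thesis using 2 5 by cases (simp; presburger)+
  next
    case 3
    consider "w < 5 * t + 22" | "\<not> w < 5 * t + 22 \<and> w < 5 * t + 23"
      | "\<not> w < 5 * t + 23 \<and> w < 5 * t + 24"
      | "\<not> w < 5 * t + 24 \<and> w < 5 * t + 25"
      | "\<not> w < 5 * t + 25 \<and> w < 5 * t + 26"
      | "\<not> w < 5 * t + 26 \<and> w < 5 * t + 27"
      | "\<not> w < 5 * t + 27 \<and> w < 5 * t + 28"
      | "\<not> w < 5 * t + 28 \<and> w < 5 * t + 29"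
      | "\<not> w < 5 * t + 29 \<and> w < 5 * t + 30"
      | "\<not> w < 5 * t + 30 \<and> w < 6 * t + 30"
      | "\<not> w < 6 * t + 30 \<and> w < 6 * t + 31"
      | "\<not> w < 6 * t + 31 \<and> w < 6 * t + 32"
      | "\<not> w < 6 * t + 32 \<and> w < 6 * t + 33"
      | "\<not> w < 6 * t + 33 \<and> w < 6 * t + 34"
      | "\<not> w < 6 * t + 34 \<and> w < 7 * t + 34"
      | "\<not> w < 7 * t + 34 \<and> w < 7 * t + 35"
      | "\<not> w < 7 * t + 35 \<and> w < 7 * t + 36"
      | "\<not> w < 7 * t + 36 \<and> w < 8 * t + 37"
      | "\<not> w < 8 * t + 37 \<and> w < 8 * t + 38"
      | "\<not> w < 8 * t + 38 \<and> w < 8 * t + 39"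
      | "\<not> w < 8 * t + 39 \<and> w < 8 * t + 40"
      | "\<not> w < 8 * t + 40 \<and> w < 8 * t + 41"
      | "\<not> w < 8 * t + 41 \<and> w < 8 * t + 42"
      | "\<not> w < 8 * t + 42 \<and> w < 10 * t + 46"
      | "\<not> w < 10 * t + 46 \<and> w < 10 * t + 47"
      | "\<not> w < 10 * t + 47 \<and> w < 10 * t + 48"
      | "\<not> w < 10 * t + 48 \<and> w < 10 * t + 49"
      | "\<not> w < 10 * t + 49 \<and> w < 10 * t + 50"
      | "\<not> w < 10 * t + 50 \<and> w < 10 * t + 51"
      | "\<not> w < 10 * t + 51 \<and> w < 10 * t + 52"
      | "\<not> w < 10 * t + 52 \<and> w < 10 * t + 53"
      | "\<not> w < 10 * t + 53 \<and> w < 12 * t + 57" | "\<not> w < 12 * t + 57"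
      by blast
    then show ?thesis using 3 5 by cases (simp; presburger)+
  qed
qed simp_all

section \<open>Cores\<close>

lemma card_triples: "triple_cover T S \<Longrightarrow> card T = card S div 3"
  using triple_cover_partition(2)[of T S] by simp

text \<open>Outside the triples only the positions 0 and m = 3n + 1 are left, both for the label m,
  so a constant core will do.\<close>

lemma num_skolem_circles_ge_no_core:
  assumes T: "triple_cover T {1..3 * n}" and "0 < n"
  shows "2 ^ (n - 1) \<le> num_skolem_circles (3 * n + 1)"
proof -
  interpret triples_and_core "3 * n + 1" "{1..3 * n}" T "\<lambda>_. 3 * n + 1"
  proof
    fix s assume "s \<in> {1..3 * n + 1} - {1..3 * n}"
    then have "s = 3 * n + 1" by auto
    then have "core_pair (3 * n + 1) {1..3 * n} (\<lambda>_. 3 * n + 1) 0 (int (3 * n + 1)) s"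
      by (auto simp: core_pair_def)
    then show "\<exists>x y. core_pair (3 * n + 1) {1..3 * n} (\<lambda>_. 3 * n + 1) x y s" by blast
  qed (use T in auto)
  have "card T = n" using card_triples[OF T] by simp
  moreover from this have "T \<noteq> {}" using assms(2) by auto
  ultimately show ?thesis using num_skolem_circles_ge_triples by simp
qed

text \<open>
  The labels \<open>1, 2, m - 2, m - 1, m\<close> go to the positions within distance \<open>2\<close> of \<open>0\<close> or \<open>m\<close>. If
  \<open>3w = 2m\<close>, the positions \<open>\<plusminus>w\<close> are at distance \<open>w\<close> and can carry the label \<open>w\<close>.
\<close>

definition five_core :: "nat \<Rightarrow> int \<Rightarrow> nat" where
  "five_core m w =
     (if w \<in> {1, 2} then 1
      else if w \<in> {int m, 2 - int m} then 2
      else if w \<in> {- 1, 1 - int m} then m - 2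
      else if w \<in> {0, int m - 1} then m - 1
      else if w \<in> {- 2, int m - 2} then m
      else 2 * m div 3)"

text \<open>The assumption on the rest lets \<open>S\<close> be all of \<open>{3..<m - 2}\<close> or
  omit 2m/3, so that one core serves both residues of \<open>m\<close>. Its labels 1 and
  \<open>m\<close> are the two fixed ones, and all triples remain free.\<close>

lemma num_skolem_circles_ge_five_core:
  assumes T: "triple_cover T S" and m8: "8 \<le> m" and S: "S \<subseteq> {3..<m - 2}"
    and rest: "\<And>w. w \<in> {3..<m - 2} - S \<Longrightarrow> 3 * w = 2 * m"
  shows "2 ^ (card S div 3) \<le> num_skolem_circles m"
proof -
  have out: "0 \<notin> S" "1 \<notin> S" "2 \<notin> S" "m - 2 \<notin> S" "m - 1 \<notin> S" "m \<notin> S"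
    using S[THEN subsetD, of 0] S[THEN subsetD, of 1] S[THEN subsetD, of 2] S[THEN subsetD, of "m - 2"]
      S[THEN subsetD, of "m - 1"] S[THEN subsetD, of m] m8 by auto
  have pairs: "core_pair m S (five_core m) 1 2 1"
    "core_pair m S (five_core m) (int m) (2 - int m) 2"
    "core_pair m S (five_core m) (1 - int m) (- 1) (m - 2)"
    "core_pair m S (five_core m) 0 (int m - 1) (m - 1)"
    "core_pair m S (five_core m) (- 2) (int m - 2) m"
    using m8 out by (auto simp: core_pair_def five_core_def cong_iff_dvd_diff nat_diff_distrib of_nat_diff)
  have rest_pair: "core_pair m S (five_core m) (int w) (- int w) w" if w: "w \<in> {3..<m - 2} - S" for w
  proof -
    have "2 * m div 3 = w" "w < m - 2" "3 \<le> w" "w \<notin> S" using rest[OF w] w by auto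
    moreover have "int w + int w + int w = 2 * int m" using rest[OF w] by simp
    ultimately show ?thesis
      by (auto simp: core_pair_def five_core_def cong_iff_dvd_diff)
  qed
  interpret triples_and_core m S T "five_core m"
  proof
    have "{3..<m - 2} \<subseteq> {1..<m}" by auto
    with S show "S \<subseteq> {1..<m}" by blast
    show "five_core m w \<in> {1..m} - S" if "- int m < w" "w \<le> int m" "nat \<bar>w\<bar> \<notin> S" for w
    proof (cases "w \<in> {1, 2, int m, 2 - int m, - 1, 1 - int m, 0, int m - 1, - 2, int m - 2}")
      case True
      then show ?thesis using m8 out by (auto simp: five_core_def)
    next
      case False
      with that m8 have "3 \<le> \<bar>w\<bar> \<and> \<bar>w\<bar> < int m - 2" by simp presburger
      with that(3) m8 have "nat \<bar>w\<bar> \<in> {3..<m - 2} - S" by auto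
      from rest[OF this] have "2 * m div 3 = nat \<bar>w\<bar>" by simp
      moreover have "five_core m w = 2 * m div 3" using False by (simp add: five_core_def)
      ultimately show ?thesis using that m8 False by auto
    qed
    show "\<exists>x y. core_pair m S (five_core m) x y s" if s: "s \<in> {1..m} - S" for s
    proof (cases "s \<in> {3..<m - 2}")
      case True
      with s rest_pair show ?thesis by blast
    next
      case False
      with s have "s = 1 \<or> s = 2 \<or> s = m - 2 \<or> s = m - 1 \<or> s = m" by auto
      with pairs show ?thesis by blast
    qed
  qed (use T m8 in auto)
  have "2 ^ card T \<le> num_skolem_circles m"
  proof (rule num_skolem_circles_ge_core[OF pairs(5,1)])
    show "\<not> [2 * 1 + int 1 = 2 * - 2] (mod 2 * int m)"
      using m8 by (auto simp: cong_iff_dvd_diff dest: zdvd_imp_le)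
    \<comment> \<open>The two sides differ by m - 7, which lies strictly between 0 and 2m because m
      is at least 8.\<close>
    show "\<not> [2 * 1 + int 1 = 2 * - 2 + int m] (mod 2 * int m)"
    proof
      assume "[2 * 1 + int 1 = 2 * - 2 + int m] (mod 2 * int m)"
      then have "2 * int m dvd int m - 7"
        by (simp add: cong_iff_dvd_diff dvd_diff_commute)
      with m8 show False by (auto dest: zdvd_imp_le)
    qed
  qed (use m8 in simp)
  then show ?thesis using card_triples[OF T] by simp
qed

section \<open>Cores given by finite tables\<close>

fun core_of_table :: "(nat \<times> int \<times> int) list \<Rightarrow> int \<Rightarrow> nat" where
  "core_of_table [] w = 0"
| "core_of_table ((s, x, y) # cs) w = (if w = x \<or> w = y then s else core_of_table cs w)"

text \<open>For a numeral \<open>m\<close> all hypotheses are finite checks on explicit lists.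
  Lookup returns the first match, so demanding \<open>core_pair\<close> of every entry rules out a
  position claimed by two labels.\<close>

lemma num_skolem_circles_ge_table:
  assumes T: "triple_cover T S" and S: "S \<subseteq> {1..<m}" and m: "0 < m"
    and table: "\<forall>(s, x, y) \<in> set cs. s \<in> {1..m} - S \<and> core_pair m S (core_of_table cs) x y s"
    and positions: "list_all (\<lambda>w. nat \<bar>w\<bar> \<in> S \<or> (\<exists>(s, x, y) \<in> set cs. w = x \<or> w = y)) [1 - int m..int m]"
    and labels: "list_all (\<lambda>s. s \<in> S \<or> s \<in> fst ` set cs) [1..<Suc m]"
    and rigid: "(m, p, q) \<in> set cs" "(s, x, y) \<in> set cs" "s < m"
      "\<not> 2 * int m dvd 2 * x + int s - 2 * p" "\<not> 2 * int m dvd 2 * x + int s - (2 * p + int m)"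
  shows "2 ^ (card S div 3) \<le> num_skolem_circles m"
proof -
  interpret triples_and_core m S T "core_of_table cs"
  proof
    show "core_of_table cs w \<in> {1..m} - S" if "- int m < w" "w \<le> int m" "nat \<bar>w\<bar> \<notin> S" for w
    proof -
      have "w \<in> set [1 - int m..int m]" using that by simp
      with positions that(3) obtain s x y where "(s, x, y) \<in> set cs" "w = x \<or> w = y"
        unfolding list_all_iff by blast
      with table show ?thesis by (fastforce simp: core_pair_def)
    qed
    show "\<exists>x y. core_pair m S (core_of_table cs) x y s" if "s \<in> {1..m} - S" for s
      
    proof -
      have "s \<in> set [1..<Suc m]" using that by auto
      with labels that have "s \<in> fst ` set cs" unfolding list_all_iff by blast
      with table show ?thesis by fastforce
    qed
  qed (use T S m in auto)
  have "2 ^ card T \<le> num_skolem_circles m"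
    by (rule num_skolem_circles_ge_core) (use table rigid in \<open>auto simp: cong_iff_dvd_diff\<close>)
  then show ?thesis using card_triples[OF T] by simp
qed

lemma triple_cover_table:
  assumes "list_all (\<lambda>w. list_ex (\<lambda>(a, b). w = a \<or> w = b \<or> w = a + b) ts) (filter P [l..<u])"
    and "S = {w \<in> {l..<u}. P w}" "0 < l" "3 * length ts \<le> card S"
  shows "triple_cover (triples [] ts) S"
  using assms by (intro triple_coverI) (auto simp: list_all_iff)

section \<open>Existence of partitions\<close>

text \<open>Orders below the range of the runs above have a partition found by computer search.\<close>

lemmas upt_simps = upt_conv_Cons[of "Suc 0"] numeral_2_eq_2[symmetric]
  upto.simps[of "- 1"] upto.simps[of 0] upto.simps[of 1]

text \<open>A triple a, b, a + b has an even sum, so the sum of the covered set must be even; for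
  \<open>{1..3 * n}\<close> this is n = 0 or 1 (mod 4).\<close>

lemma ex_skolem_cover:
  assumes "n mod 4 < 2" "4 \<le> n"
  shows "\<exists>T. triple_cover T {1..3 * n}"
proof -
  have "n = 4 \<or> n = 5
    \<or> (\<exists>t. n = 4 * t + 8) \<or> (\<exists>t. n = 4 * t + 9)"
    using assms by presburger
  then show ?thesis
  proof (elim disjE exE)
    assume n: "n = 4"
    have "triple_cover (triples [] [(1, 6), (2, 10), (3, 8), (4, 5)])
        ({1..12})"
      by (rule triple_cover_table[of _ "\<lambda>_. True" 1 13]) (simp add: upt_simps | fastforce)+
    with n show ?thesis by auto
  next
    assume n: "n = 5"
    have "triple_cover (triples [] [(1, 14), (2, 7), (3, 10), (4, 8), (5, 6)])
        ({1..15})"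
      by (rule triple_cover_table[of _ "\<lambda>_. True" 1 16]) (simp add: upt_simps | fastforce)+
    with n show ?thesis by auto
  next
    fix t assume "n = 4 * t + 8"
    then have *: "3 * n = 12 * t + 24" by simp_all
    show ?thesis unfolding * using skolem_cover_0[of t] by blast
  next
    fix t assume "n = 4 * t + 9"
    then have *: "3 * n = 12 * t + 27" by simp_all
    show ?thesis unfolding * using skolem_cover_1[of t] by blast
  qed
qed

text \<open>Langford sequences of smallest label 3 need length at least 5. For n = 4, say, the
  largest entries of the triples would have to add up to 51, half the sum of \<open>{3..14}\<close>,
  but its four largest elements add up to only 50.\<close>

lemma ex_langford_cover:
  assumes "n mod 4 < 2" "5 \<le> n"
  shows "\<exists>T. triple_cover T {3..3 * n + 2}"
proof -
  have "n = 5 \<or> n = 8 \<or> n = 9 \<or> n = 12 \<or> n = 13 \<or> n = 16 \<or> n = 17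
    \<or> (\<exists>t. n = 4 * t + 20) \<or> (\<exists>t. n = 4 * t + 21)"
    using assms by presburger
  then show ?thesis
  proof (elim disjE exE)
    assume n: "n = 5"
    have "triple_cover (triples [] [(3, 10), (4, 12), (5, 9), (6, 11), (7, 8)])
        ({3..17})"
      by (rule triple_cover_table[of _ "\<lambda>_. True" 3 18]) (simp add: upt_simps | fastforce)+
    with n show ?thesis by auto
  next
    assume n: "n = 8"
    have "triple_cover (triples [] [(3, 13), (4, 19), (5, 20), (6, 18), (7, 14), (8, 9), (10, 12), (11, 15)])
        ({3..26})"
      by (rule triple_cover_table[of _ "\<lambda>_. True" 3 27]) (simp add: upt_simps | fastforce)+
    with n show ?thesis by auto
  next
    assume n: "n = 9"
    have "triple_cover (triples [] [(3, 19), (4, 10), (5, 20), (6, 23), (7, 17), (8, 18), (9, 12), (11, 16), (13, 15)])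
        ({3..29})"
      by (rule triple_cover_table[of _ "\<lambda>_. True" 3 30]) (simp add: upt_simps | fastforce)+
    with n show ?thesis by auto
  next
    assume n: "n = 12"
    have "triple_cover (triples [] [(3, 28), (4, 30), (5, 32), (6, 23), (7, 20), (8, 10), (9, 24), (11, 15), (12, 13),
          (14, 21), (16, 22), (17, 19)])
        ({3..38})"
      by (rule triple_cover_table[of _ "\<lambda>_. True" 3 39]) (simp add: upt_simps | fastforce)+
    with n show ?thesis by auto
  next
    assume n: "n = 13"
    have "triple_cover (triples [] [(3, 23), (4, 31), (5, 36), (6, 33), (7, 18), (8, 32), (9, 19), (10, 20), (11, 16),
          (12, 22), (13, 24), (14, 15), (17, 21)])
        ({3..41})"
      by (rule triple_cover_table[of _ "\<lambda>_. True" 3 42]) (simp add: upt_simps | fastforce)+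
    with n show ?thesis by auto
  next
    assume n: "n = 16"
    have "triple_cover (triples [] [(3, 38), (4, 25), (5, 18), (6, 43), (7, 33), (8, 37), (9, 39), (10, 24), (11, 36),
          (12, 30), (13, 19), (14, 21), (15, 16), (17, 27), (20, 26), (22, 28)])
        ({3..50})"
      by (rule triple_cover_table[of _ "\<lambda>_. True" 3 51]) (simp add: upt_simps | fastforce)+
    with n show ?thesis by auto
  next
    assume n: "n = 17"
    have "triple_cover (triples [] [(3, 36), (4, 37), (5, 25), (6, 11), (7, 44), (8, 40), (9, 43), (10, 28), (12, 33),
          (13, 19), (14, 35), (15, 31), (16, 18), (20, 22), (21, 26), (23, 27),
          (24, 29)])
        ({3..53})"
      by (rule triple_cover_table[of _ "\<lambda>_. True" 3 54]) (simp add: upt_simps | fastforce)+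
    with n show ?thesis by auto
  next
    fix t assume "n = 4 * t + 20"
    then have *: "3 * n + 2 = 12 * t + 62" by simp_all
    show ?thesis unfolding * using langford_cover_0[of t] by blast
  next
    fix t assume "n = 4 * t + 21"
    then have *: "3 * n + 2 = 12 * t + 65" by simp_all
    show ?thesis unfolding * using langford_cover_1[of t] by blast
  qed
qed

text \<open>For m = 3n + 6 the missing element 2n + 4 is 2m/3. The residues of \<open>n\<close> make
  the sum even; n = 1 and n = 2 satisfy this too but admit no partition.\<close>

lemma ex_holed_cover:
  assumes "(n + 3) mod 4 < 2" "5 \<le> n"
  shows "\<exists>T. triple_cover T ({3..3 * n + 3} - {2 * n + 4})"
proof -
  have "n = 5 \<or> n = 6 \<or> n = 9 \<or> n = 10 \<or> n = 13 \<or> n = 14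
    \<or> (\<exists>t. n = 4 * t + 17) \<or> (\<exists>t. n = 4 * t + 18)"
    using assms by presburger
  then show ?thesis
  proof (elim disjE exE)
    assume n: "n = 5"
    have "triple_cover (triples [] [(3, 8), (4, 13), (5, 10), (6, 12), (7, 9)])
        ({3..18} - {14})"
      by (rule triple_cover_table[of _ "\<lambda>w. w \<noteq> 14" 3 19]) (simp add: upt_simps | fastforce)+
    with n show ?thesis by auto
  next
    assume n: "n = 6"
    have "triple_cover (triples [] [(3, 17), (4, 9), (5, 10), (6, 12), (7, 14), (8, 11)])
        ({3..21} - {16})"
      by (rule triple_cover_table[of _ "\<lambda>w. w \<noteq> 16" 3 22]) (simp add: upt_simps | fastforce)+
    with n show ?thesis by auto
  next
    assume n: "n = 9"
    have "triple_cover (triples [] [(3, 27), (4, 12), (5, 21), (6, 13), (7, 17), (8, 15), (9, 20), (10, 18), (11, 14)])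
        ({3..30} - {22})"
      by (rule triple_cover_table[of _ "\<lambda>w. w \<noteq> 22" 3 31]) (simp add: upt_simps | fastforce)+
    with n show ?thesis by auto
  next
    assume n: "n = 10"
    have "triple_cover (triples [] [(3, 27), (4, 13), (5, 26), (6, 16), (7, 18), (8, 12), (9, 19), (10, 23), (11, 21),
          (14, 15)])
        ({3..33} - {24})"
      by (rule triple_cover_table[of _ "\<lambda>w. w \<noteq> 24" 3 34]) (simp add: upt_simps | fastforce)+
    with n show ?thesis by auto
  next
    assume n: "n = 13"
    have "triple_cover (triples [] [(3, 34), (4, 25), (5, 28), (6, 35), (7, 16), (8, 19), (9, 31), (10, 32), (11, 13),
          (12, 14), (15, 21), (17, 22), (18, 20)])
        ({3..42} - {30})"
      by (rule triple_cover_table[of _ "\<lambda>w. w \<noteq> 30" 3 43]) (simp add: upt_simps | fastforce)+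
    with n show ?thesis by auto
  next
    assume n: "n = 14"
    have "triple_cover (triples [] [(3, 42), (4, 40), (5, 31), (6, 19), (7, 34), (8, 30), (9, 26), (10, 18), (11, 16),
          (12, 17), (13, 20), (14, 23), (15, 24), (21, 22)])
        ({3..45} - {32})"
      by (rule triple_cover_table[of _ "\<lambda>w. w \<noteq> 32" 3 46]) (simp add: upt_simps | fastforce)+
    with n show ?thesis by auto
  next
    fix t assume "n = 4 * t + 17"
    then have *: "3 * n + 3 = 12 * t + 54" "2 * n + 4 = 8 * t + 38" by simp_all
    show ?thesis unfolding * using holed_cover_1[of t] by blast
  next
    fix t assume "n = 4 * t + 18"
    then have *: "3 * n + 3 = 12 * t + 57" "2 * n + 4 = 8 * t + 40" by simp_all
    show ?thesis unfolding * using holed_cover_2[of t] by blast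
  qed
qed

section \<open>Exceptional orders\<close>

lemma num_skolem_circles_8: "2 \<le> num_skolem_circles 8"
proof -
  have "2 ^ (card ({1, 3, 4} :: nat set) div 3) \<le> num_skolem_circles 8"
  proof (rule num_skolem_circles_ge_table)
    show "triple_cover {(1, 3)} {1, 3, 4}"
      by (simp add: triple_cover_def)
    show "(8, - 6, 2) \<in> set [(2, 5, 7), (5, 6, - 5), (6, 8, - 2), (7, - 7, 0), (8, - 6, 2)]"
      "(5, 6, - 5) \<in> set [(2, 5, 7), (5, 6, - 5), (6, 8, - 2), (7, - 7, 0), (8, - 6, 2)]"
      by simp_all
  qed (simp_all add: core_pair_def cong_def upt_simps)
  then show ?thesis by simp
qed

lemma num_skolem_circles_9: "2 \<le> num_skolem_circles 9"
proof -
  have "2 ^ (card ({1, 2, 3} :: nat set) div 3) \<le> num_skolem_circles 9"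
  proof (rule num_skolem_circles_ge_table)
    show "triple_cover {(1, 2)} {1, 2, 3}"
      by (simp add: triple_cover_def)
    show "(9, 0, 9) \<in> set [(4, 8, - 6), (5, 6, - 7), (6, 4, - 8), (7, 7, - 4), (8, 5, - 5), (9, 0, 9)]"
      "(4, 8, - 6) \<in> set [(4, 8, - 6), (5, 6, - 7), (6, 4, - 8), (7, 7, - 4), (8, 5, - 5), (9, 0, 9)]"
      by simp_all
  qed (simp_all add: core_pair_def cong_def upt_simps)
  then show ?thesis by simp
qed

lemma num_skolem_circles_12: "4 \<le> num_skolem_circles 12"
proof -
  have "2 ^ (card ({1, 2, 3, 5, 6, 11} :: nat set) div 3) \<le> num_skolem_circles 12"
  proof (rule num_skolem_circles_ge_table)
    show "triple_cover {(1, 2), (5, 6)} {1, 2, 3, 5, 6, 11}"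
      by (simp add: triple_cover_def)
    show "(12, - 8, 4) \<in> set [(4, 10, - 10), (7, 8, - 9), (8, 12, - 4), (9, 0, 9), (10, 7, - 7), (12, - 8, 4)]"
      "(4, 10, - 10) \<in> set [(4, 10, - 10), (7, 8, - 9), (8, 12, - 4), (9, 0, 9), (10, 7, - 7), (12, - 8, 4)]"
      by simp_all
  qed (simp_all add: core_pair_def cong_def upt_simps)
  then show ?thesis by simp
qed

lemma num_skolem_circles_17: "8 \<le> num_skolem_circles 17"
proof -
  have "2 ^ (card ({1, 2, 3, 4, 5, 6, 10, 11, 16} :: nat set) div 3) \<le> num_skolem_circles 17"
  proof (rule num_skolem_circles_ge_table)
    show "triple_cover {(1, 2), (4, 6), (5, 11)} {1, 2, 3, 4, 5, 6, 10, 11, 16}"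
      by (simp add: triple_cover_def)
    show "(17, - 9, 8) \<in> set [(7, 15, - 12), (8, 9, 17), (9, 12, - 13), (12, 14, - 8), (13, 7, - 14), (14, 13, - 7),
      (15, - 15, 0), (17, - 9, 8)]"
      "(7, 15, - 12) \<in> set [(7, 15, - 12), (8, 9, 17), (9, 12, - 13), (12, 14, - 8), (13, 7, - 14), (14, 13, - 7),
      (15, - 15, 0), (17, - 9, 8)]"
      by simp_all
  qed (simp_all add: core_pair_def cong_def upt_simps)
  then show ?thesis by simp
qed

section \<open>The lower bound\<close>

text \<open>For m \<ge> 8 the denominator is at least 5, which reduces the claim to an inequality of
  natural numbers.\<close>

lemma circle_bound:
  fixes m N :: nat
  assumes "8 \<le> m" and N: "2 ^ (m div 3 - 1) + 5 \<le> 5 * N"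
  shows "2 ^ (nat \<lfloor>real m / 3\<rfloor> - 1) / (2 + log 2 (real m)) + 1 \<le> real N"
proof -
  have log: "5 \<le> 2 + log 2 (real m)"
    using assms(1) by (simp add: le_log_iff)
  have "nat \<lfloor>real m / 3\<rfloor> = m div 3"
    using floor_divide_of_nat_eq[of m 3, where 'a = real] by simp
  moreover have "2 ^ (m div 3 - 1) / (2 + log 2 (real m)) \<le> 2 ^ (m div 3 - 1) / (5 :: real)"
    using log by (intro divide_left_mono) auto
  moreover have "2 ^ (m div 3 - 1) + 5 \<le> 5 * real N"
    using of_nat_mono[OF N, where 'a = real] by simp
  ultimately show ?thesis by (simp only:)
qed

lemma num_skolem_circles_ge_exponential:
  assumes m: "8 \<le> m" and mod4: "m mod 4 = 0 \<or> m mod 4 = 1"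
  shows "2 ^ (m div 3 - 1) + 5 \<le> 5 * num_skolem_circles m"
proof -
  \<comment> \<open>The residue of \<open>m\<close> modulo 3 selects the construction. The four
    separate orders would have n = 1 or 4 in the second family and n = 1 or 2 in the third, where no
    partition exists.\<close>
  have "m = 8 \<or> m = 9 \<or> m = 12 \<or> m = 17
    \<or> (\<exists>n. m = 3 * n + 1 \<and> 4 \<le> n \<and> n mod 4 < 2)
    \<or> (\<exists>n. m = 3 * n + 5 \<and> 5 \<le> n \<and> n mod 4 < 2)
    \<or> (\<exists>n. m = 3 * n + 6 \<and> 5 \<le> n \<and> (n + 3) mod 4 < 2)"
    using assms by presburger
  then show ?thesis
  proof (elim disjE exE conjE)
    assume "m = 8"
    then show ?thesis using num_skolem_circles_8 by simp
  next
    assume "m = 9"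
    then show ?thesis using num_skolem_circles_9 by simp
  next
    assume "m = 12"
    then show ?thesis using num_skolem_circles_12 by simp
  next
    assume "m = 17"
    then show ?thesis using num_skolem_circles_17 by simp
  next
    fix n assume n: "m = 3 * n + 1" "4 \<le> n" "n mod 4 < 2"
    obtain T where "triple_cover T {1..3 * n}"
      using ex_skolem_cover[OF n(3,2)] by blast
    then have "2 ^ (n - 1) \<le> num_skolem_circles m"
      using num_skolem_circles_ge_no_core n by simp
    moreover have "2 ^ 3 \<le> (2 :: nat) ^ (n - 1)"
      using n(2) by (intro power_increasing) auto
    moreover have "m div 3 = n" using n(1) by simp
    ultimately show ?thesis by simp
  next
    fix n assume n: "m = 3 * n + 5" "5 \<le> n" "n mod 4 < 2"
    let ?S = "{3..3 * n + 2}"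
    obtain T where "triple_cover T ?S"
      using ex_langford_cover[OF n(3,2)] by blast
    then have "2 ^ (card ?S div 3) \<le> num_skolem_circles m"
    proof (rule num_skolem_circles_ge_five_core[OF _ m])
      show "?S \<subseteq> {3..<m - 2}" using n(1) by auto
      show "3 * w = 2 * m" if "w \<in> {3..<m - 2} - ?S" for w
        using that n(1) by auto
    qed
    then have "2 ^ n \<le> num_skolem_circles m" by simp
    moreover have "2 ^ 5 \<le> (2 :: nat) ^ n"
      using n(2) by (intro power_increasing) auto
    moreover have "m div 3 - 1 = n" using n(1) by simp
    ultimately show ?thesis by simp
  next
    fix n assume n: "m = 3 * n + 6" "5 \<le> n" "(n + 3) mod 4 < 2"
    let ?S = "{3..3 * n + 3} - {2 * n + 4}"
    obtain T where "triple_cover T ?S"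
      using ex_holed_cover[OF n(3,2)] by blast
    then have "2 ^ (card ?S div 3) \<le> num_skolem_circles m"
    proof (rule num_skolem_circles_ge_five_core[OF _ m])
      show "?S \<subseteq> {3..<m - 2}" using n(1) by auto
      show "3 * w = 2 * m" if "w \<in> {3..<m - 2} - ?S" for w
        using that n(1) by auto
    qed
    moreover have "card ?S = 3 * n"
      using n(2) by simp
    ultimately have "2 ^ n \<le> num_skolem_circles m" by simp
    moreover have "2 ^ 5 \<le> (2 :: nat) ^ n"
      using n(2) by (intro power_increasing) auto
    \<comment> \<open>The power obtained is half the one required; 2 * 2^n + 5 \<le> 5 * 2^n still
      holds.\<close>
    moreover have "m div 3 - 1 = Suc n" using n(1) by simp
    ultimately show ?thesis by simp
  qed
qed

theorem theorem11:
  fixes m :: nat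
  assumes "m \<ge> 8"
    and "[m = 0] (mod 4) \<or> [m = 1] (mod 4)"
  shows "real (num_skolem_circles m)
    \<ge> 2 ^ (nat \<lfloor>real m / 3\<rfloor> - 1) / (2 + log 2 (real m)) + 1"
  using assms by (intro circle_bound num_skolem_circles_ge_exponential) (auto simp: cong_def)

end
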